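(* Let $(E,\Delta)$ be a complete separable metric space. Let $\xi=(\xi_x)_{x\in F}$ be an $E$-valued process indexed by $F$ and let $C,\beta,\gamma>0$ be such that $$\mathbb E\left[\Delta(\xi_x,\xi_y)^\beta\right]\le C\,R(x,y)^{d_H+\gamma}$$ for all $x,y\in F$. Then there exists a version of $\xi$ which is almost surely essentially $\frac{\gamma}{\beta}$-Hölder continuous with respect to $R$.
   Context: Setting. Let $M\ge2$, $I=\{1,\dots,M\}$, let $F$ be a connected compact metric space and $\psi_i:F\to F$ ($i\in I$) injective strict contractions with $F=\bigcup_i\psi_i(F)$. Let $\mathbb W_n=I^n$ ($\mathbb W_0$ contains only the empty word), $\mathbb W_*=\bigcup_{n\ge0}\mathbb W_n$, $\mathbb W=I^{\mathbb N}$. For $w=w_1\dots w_n\in\mathbb W_*$ put $\psi_w=\psi_{w_1}\circ\dots\circ\psi_{w_n}$, $F_w=\psi_w(F)$. Let $\pi:\mathbb W\to F$ be given by $\{\pi(w)\}=\bigcap_nF_{w_1\dots w_n}$. With $\sigma$ the left shift on $\mathbb W$, the post-critical set is $P=\bigcup_{n\ge1}\sigma^n\big(\pi^{-1}(\bigcup_{i\ne j}F_i\cap F_j)\big)$; assume $P$ is finite (so $(F,(\psi_i))$ is a connected post-critically finite self-similar set). Put $F^0=\pi(P)$, $F^n=\bigcup_{w\in\mathbb W_n}\psi_w(F^0)$. Let $(A_0,\mathbf r)$ be a regular irreducible harmonic structure: $\mathbf r=(r_1,\dots,r_M)$ with all $r_i\in(0,1)$; $A_0$ is a real symmetric matrix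 indexed by $F^0$, non-positive definite, with non-negative off-diagonal entries and kernel exactly the constants; and, with $\mathcal E_0(f,g)=-\sum_{x,y\in F^0}f(x)A_0(x,y)g(y)$, $r_w=\prod_ir_{w_i}$ and $\mathcal E_n(f,g)=\sum_{w\in\mathbb W_n}r_w^{-1}\mathcal E_0(f\circ\psi_w|_{F^0},g\circ\psi_w|_{F^0})$ for $f,g:F^n\to\mathbb R$, one has $\mathcal E_0(f,f)=\min\{\mathcal E_1(g,g):g|_{F^0}=f\}$ for all $f$. Let $\mathcal D=\{f\in C(F):\lim_n\mathcal E_n(f|_{F^n},f|_{F^n})<\infty\}$ and $\mathcal E(f,g)=\lim_n\mathcal E_n(f|_{F^n},g|_{F^n})$. The resistance metric is $R(x,y)=(\inf\{\mathcal E(f,f):f\in\mathcal D,f(x)=0,f(y)=1\})^{-1}$ for $x\neq y$, $R(x,x)=0$; it induces the topology of $F$. Let $d_H>0$ be the unique number with $\sum_ir_i^{d_H}=1$. A version of $\xi$ is a process on the same probability space and index set agreeing with $\xi$ almost surely at each index. A continuous map $f$ between metric spaces $(M_1,d_1),(M_2,d_2)$ is essentially $\delta$-Hölder continuous ($\delta>0$) if for every $\gamma'\in(0,\delta)$ there is a constant $\epsilon_{\gamma'}$ with $d_2(f(x),f(y))\le\epsilon_{\gamma'}d_1(x,y)^{\gamma'}$ for all $x,y$. *)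

theory Defs
  imports "HOL-Probability.Probability"
begin

(* The alphabet is {1..M}. Finite words are lists; an infinite word w_1 w_2 ... is a function
   on nat whose value at n is the letter w_{n+1}. *)

definition words :: "nat \<Rightarrow> nat \<Rightarrow> nat list set" where
  "words M n = {w. length w = n \<and> set w \<subseteq> {1..M}}"

definition inf_words :: "nat \<Rightarrow> (nat \<Rightarrow> nat) set" where
  "inf_words M = {w. \<forall>n. w n \<in> {1..M}}"

definition shift :: "(nat \<Rightarrow> nat) \<Rightarrow> nat \<Rightarrow> nat" where
  "shift w = (\<lambda>n. w (Suc n))"

primrec comp_word :: "(nat \<Rightarrow> 'a \<Rightarrow> 'a) \<Rightarrow> nat list \<Rightarrow> 'a \<Rightarrow> 'a" where
  "comp_word \<psi> [] = id"
| "comp_word \<psi> (i # w) = \<psi> i \<circ> comp_word \<psi> w"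

definition coding :: "'a set \<Rightarrow> (nat \<Rightarrow> 'a \<Rightarrow> 'a) \<Rightarrow> (nat \<Rightarrow> nat) \<Rightarrow> 'a" where
  "coding F \<psi> w = (THE x. (\<Inter>n. comp_word \<psi> (map w [0..<n]) ` F) = {x})"

definition post_critical :: "nat \<Rightarrow> 'a set \<Rightarrow> (nat \<Rightarrow> 'a \<Rightarrow> 'a) \<Rightarrow> (nat \<Rightarrow> nat) set" where
  "post_critical M F \<psi> =
     (\<Union>n\<in>{1..}. (shift ^^ n) `
        {w \<in> inf_words M.
           coding F \<psi> w \<in> (\<Union>i\<in>{1..M}. \<Union>j\<in>{1..M} - {i}. \<psi> i ` F \<inter> \<psi> j ` F)})"

definition connected_pcf_set ::
  "nat \<Rightarrow> 'a::metric_space set \<Rightarrow> (nat \<Rightarrow> 'a \<Rightarrow> 'a) \<Rightarrow> bool" where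
  "connected_pcf_set M F \<psi> \<longleftrightarrow>
     2 \<le> M \<and> F \<noteq> {} \<and> compact F \<and> connected F \<and>
     (\<forall>i\<in>{1..M}. inj_on (\<psi> i) F \<and> (\<exists>L<1. L-lipschitz_on F (\<psi> i))) \<and>
     F = (\<Union>i\<in>{1..M}. \<psi> i ` F) \<and>
     finite (post_critical M F \<psi>)"

definition boundary0 :: "nat \<Rightarrow> 'a set \<Rightarrow> (nat \<Rightarrow> 'a \<Rightarrow> 'a) \<Rightarrow> 'a set" where
  "boundary0 M F \<psi> = coding F \<psi> ` post_critical M F \<psi>"

(* Functions on the finite vertex sets F^n and on F are represented by total functions;
   energy0 depends only on the values on V = F^0, and energy n only on the values on
   F^n, the union of the images of F^0 under the n-fold compositions. *)

definition energy0 :: "'a set \<Rightarrow> ('a \<Rightarrow> 'a \<Rightarrow> real) \<Rightarrow> ('a \<Rightarrow> real) \<Rightarrow> ('a \<Rightarrow> real) \<Rightarrow> real" where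
  "energy0 V A f g = - (\<Sum>x\<in>V. \<Sum>y\<in>V. f x * A x y * g y)"

definition energy ::
  "nat \<Rightarrow> 'a set \<Rightarrow> (nat \<Rightarrow> 'a \<Rightarrow> 'a) \<Rightarrow> ('a \<Rightarrow> 'a \<Rightarrow> real) \<Rightarrow> (nat \<Rightarrow> real)
    \<Rightarrow> nat \<Rightarrow> ('a \<Rightarrow> real) \<Rightarrow> ('a \<Rightarrow> real) \<Rightarrow> real" where
  "energy M F \<psi> A r n f g =
     (\<Sum>w\<in>words M n. inverse (prod_list (map r w)) *
        energy0 (boundary0 M F \<psi>) A (f \<circ> comp_word \<psi> w) (g \<circ> comp_word \<psi> w))"

(* Irreducibility is the requirement that the kernel consists of the constants only,
   regularity the requirement that all r i are less than 1. The last two conjuncts say that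
   the minimum of the level-1 energy over all extensions of f is attained and equals the
   level-0 energy of f. *)

definition regular_harmonic_structure ::
  "nat \<Rightarrow> 'a set \<Rightarrow> (nat \<Rightarrow> 'a \<Rightarrow> 'a) \<Rightarrow> ('a \<Rightarrow> 'a \<Rightarrow> real) \<Rightarrow> (nat \<Rightarrow> real) \<Rightarrow> bool" where
  "regular_harmonic_structure M F \<psi> A r \<longleftrightarrow>
     (let V = boundary0 M F \<psi> in
       (\<forall>i\<in>{1..M}. 0 < r i \<and> r i < 1) \<and>
       (\<forall>x\<in>V. \<forall>y\<in>V. A x y = A y x) \<and>
       (\<forall>f :: 'a \<Rightarrow> real. (\<Sum>x\<in>V. \<Sum>y\<in>V. f x * A x y * f y) \<le> 0) \<and>
       (\<forall>x\<in>V. \<forall>y\<in>V. x \<noteq> y \<longrightarrow> 0 \<le> A x y) \<and>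
       (\<forall>f :: 'a \<Rightarrow> real.
          (\<forall>x\<in>V. (\<Sum>y\<in>V. A x y * f y) = 0) \<longleftrightarrow> (\<exists>c. \<forall>x\<in>V. f x = c)) \<and>
       (\<forall>f :: 'a \<Rightarrow> real.
          (\<exists>g. (\<forall>x\<in>V. g x = f x) \<and> energy M F \<psi> A r 1 g g = energy0 V A f f) \<and>
          (\<forall>g. (\<forall>x\<in>V. g x = f x) \<longrightarrow> energy0 V A f f \<le> energy M F \<psi> A r 1 g g)))"

(* For a harmonic structure the energies of a fixed f increase with n, so convergence in
   the reals means that the limit is finite. *)

definition dirichlet_domain ::
  "nat \<Rightarrow> 'a::metric_space set \<Rightarrow> (nat \<Rightarrow> 'a \<Rightarrow> 'a) \<Rightarrow> ('a \<Rightarrow> 'a \<Rightarrow> real) \<Rightarrow> (nat \<Rightarrow> real)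
    \<Rightarrow> ('a \<Rightarrow> real) set" where
  "dirichlet_domain M F \<psi> A r =
     {f. continuous_on F f \<and> convergent (\<lambda>n. energy M F \<psi> A r n f f)}"

definition dirichlet_form ::
  "nat \<Rightarrow> 'a set \<Rightarrow> (nat \<Rightarrow> 'a \<Rightarrow> 'a) \<Rightarrow> ('a \<Rightarrow> 'a \<Rightarrow> real) \<Rightarrow> (nat \<Rightarrow> real)
    \<Rightarrow> ('a \<Rightarrow> real) \<Rightarrow> ('a \<Rightarrow> real) \<Rightarrow> real" where
  "dirichlet_form M F \<psi> A r f g = lim (\<lambda>n. energy M F \<psi> A r n f g)"

definition resistance ::
  "nat \<Rightarrow> 'a::metric_space set \<Rightarrow> (nat \<Rightarrow> 'a \<Rightarrow> 'a) \<Rightarrow> ('a \<Rightarrow> 'a \<Rightarrow> real) \<Rightarrow> (nat \<Rightarrow> real)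
    \<Rightarrow> 'a \<Rightarrow> 'a \<Rightarrow> real" where
  "resistance M F \<psi> A r x y =
     (if x = y then 0
      else inverse (Inf {dirichlet_form M F \<psi> A r f f | f.
             f \<in> dirichlet_domain M F \<psi> A r \<and> f x = 0 \<and> f y = 1}))"

(* d1 and d2 are the metrics of the source S and of the target; they are passed as
   functions because the source metric of interest is not the one of the type. The first
   conjunct is continuity with respect to d1 and d2. *)

definition essentially_hoelder ::
  "'a set \<Rightarrow> ('a \<Rightarrow> 'a \<Rightarrow> real) \<Rightarrow> ('b \<Rightarrow> 'b \<Rightarrow> real) \<Rightarrow> real \<Rightarrow> ('a \<Rightarrow> 'b) \<Rightarrow> bool" where
  "essentially_hoelder S d1 d2 \<delta> f \<longleftrightarrow>
     (\<forall>x\<in>S. \<forall>e>0. \<exists>d>0. \<forall>y\<in>S. d1 x y < d \<longrightarrow> d2 (f x) (f y) < e) \<and>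
     (\<forall>\<gamma>'. 0 < \<gamma>' \<and> \<gamma>' < \<delta> \<longrightarrow>
        (\<exists>c. \<forall>x\<in>S. \<forall>y\<in>S. d2 (f x) (f y) \<le> c * d1 x y powr \<gamma>'))"

definition is_process :: "'w measure \<Rightarrow> 'a set \<Rightarrow> ('a \<Rightarrow> 'w \<Rightarrow> 'e::topological_space) \<Rightarrow> bool" where
  "is_process \<Omega> F \<xi> \<longleftrightarrow> (\<forall>x\<in>F. \<xi> x \<in> borel_measurable \<Omega>)"

definition is_version ::
  "'w measure \<Rightarrow> 'a set \<Rightarrow> ('a \<Rightarrow> 'w \<Rightarrow> 'e::topological_space) \<Rightarrow> ('a \<Rightarrow> 'w \<Rightarrow> 'e) \<Rightarrow> bool" where
  "is_version \<Omega> F \<xi> \<eta> \<longleftrightarrow>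
     is_process \<Omega> F \<eta> \<and> (\<forall>x\<in>F. AE \<omega> in \<Omega>. \<eta> x \<omega> = \<xi> x \<omega>)"

end

theory Submission
  imports Defs "HOL-Real_Asymp.Real_Asymp"
begin

text \<open>
  The argument separates probability from the geometry of the fractal. The link between the two is the
  metric \<open>\<rho> = sqrt (R / \<kappa>)\<close>, where \<open>R\<close> is the resistance and \<open>\<kappa>\<close> a constant that makes the
  \<open>\<rho>\<close>-diameter of \<open>F\<close> at most 1. Passing to the square root makes the triangle inequality almost
  free: \<open>R x y\<close> is the supremum of \<open>(f x - f y)\<^sup>2 / \<E>(f, f)\<close> over the domain, so its square root is a
  supremum of normalised increments, and increments add along \<open>x\<close>, \<open>y\<close>, \<open>z\<close>
  (\<open>sqrt_R_triangle\<close>). The exponents only double.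

  The probabilistic half, \<open>kolmogorov_continuity_entropy\<close>, is a Kolmogorov continuity theorem on
  a metric space about which only an upper bound on covering numbers is known. Chaining needs a
  bound on increments between neighbouring points of a net, and without any doubling property a net
  point may have very many neighbours. The remedy is \<open>sparse_pairs\<close>: within a net of \<open>n\<close> points one
  can select at most \<open>2 n\<close> pairs, whose distances exceed the mesh only by a factor of order \<open>ln n\<close>,
  so that every pair of close points is joined by two selected pairs. The logarithm costs a
  polynomial factor in the level, which the gap between the exponent in question and
  \<open>\<gamma> / \<beta>\<close> absorbs.

  The geometric half has to provide such a bound on covering numbers and to show that \<open>R\<close> is finite
  and positive off the diagonal. Everything rests on one estimate: the energy \<open>E 1\<close> controls the
  oscillation on the first-level vertices (\<open>E1_controls\<close>), because \<open>F\<close> is connected and cells meet only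
  at vertices. Iterating it along an infinite word, where the energies decay geometrically since all
  \<open>r i\<close> are less than 1, gives two things. On a cell of word \<open>w\<close>, a function of the domain
  oscillates by at most a constant times the square root of \<open>r_word w\<close> times its energy
  (\<open>cell_osc\<close>); hence the resistance between two points of that cell is at most \<open>\<kappa> * r_word w\<close>.
  And minimal extensions of boundary values, iterated along a word, converge; this constructs
  harmonic functions on \<open>F\<close>, and piecewise harmonic functions separate points
  (\<open>dirichlet_domain_separates\<close>), which keeps the infimum in the definition of \<open>R\<close> from being taken over
  the empty set.

  Finally, stopping each infinite word as soon as \<open>r_word w\<close> drops to a level \<open>s\<close> yields a finite
  family of words whose cells cover \<open>F\<close> and for which the sum of \<open>r_word w powr d\<^sub>H\<close> is at most 1
  (\<open>stopping_words\<close>), so there are at most a constant times \<open>s powr - d\<^sub>H\<close> of them. As these cells have \<open>\<rho>\<close>-diameter at most \<open>sqrt s\<close>, the covering exponent of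
  \<open>\<rho>\<close> is \<open>2 * d\<^sub>H\<close>, the moment exponent is \<open>2 * (d\<^sub>H + \<gamma>)\<close>, and half the difference per power
  \<open>\<beta>\<close>, measured in \<open>R\<close>, is \<open>\<gamma> / \<beta>\<close>.
\<close>

section \<open>Kolmogorov continuity from covering numbers\<close>

text \<open>Greedy selection, an idea from the theory of generic chaining. Around a remaining point \<open>a\<close> the
balls of radius \<open>j * c\<close> cannot double in size for every \<open>j \<le> m\<close>, as there are at most \<open>2 ^ m\<close>
points. At a radius where doubling fails, join \<open>a\<close> to the whole ball of radius \<open>(j + 1) * c\<close> and
discard the ball of radius \<open>j * c\<close>: the number of new pairs is paid for by the discarded points.
When the first of two \<open>c\<close>-close points is discarded, the other still lies in the larger ball, so
both have just been joined to the same \<open>a\<close>.\<close>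

lemma sparse_pairs:
  fixes \<rho> :: "'a \<Rightarrow> 'a \<Rightarrow> real"
  assumes "Metric_space S \<rho>" and "finite T" and "T \<subseteq> S" and "card T \<le> 2 ^ m" and "0 \<le> c"
  shows "\<exists>U. U \<subseteq> T \<times> T \<and> card U \<le> 2 * card T \<and>
           (\<forall>(u, v)\<in>U. \<rho> u v \<le> (real m + 1) * c) \<and>
           (\<forall>s\<in>T. \<forall>t\<in>T. \<rho> s t \<le> c \<longrightarrow> (\<exists>u. (u, s) \<in> U \<and> (u, t) \<in> U))"
  using assms(2-4)
proof (induction T rule: finite_psubset_induct)
  case (psubset T)
  interpret Metric_space S \<rho> by fact
  show ?case
  proof (cases "T = {}")
    case True
    then show ?thesis by (intro exI[of _ "{}"]) auto
  next
    case False
    then obtain a where a: "a \<in> T" by blast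
    define B where "B j = {s \<in> T. \<rho> a s \<le> real j * c}" for j :: nat
    have finB: "finite (B j)" "B j \<subseteq> T" for j using psubset.hyps by (auto simp: B_def)
    have aB: "a \<in> B j" for j using a psubset.prems \<open>0 \<le> c\<close> by (auto simp: B_def)
    have "\<exists>j\<le>m. card (B (Suc j)) \<le> 2 * card (B j)"
    proof (rule ccontr)
      assume no_j: "\<not> ?thesis"
      then have doubling: "2 * card (B j) < card (B (Suc j))" if "j \<le> m" for j
        using no_j that by force
      have "2 ^ j \<le> card (B j)" if "j \<le> Suc m" for j
        using that
      proof (induction j)
        case 0
        have "card {a} \<le> card (B 0)" using aB finB by (intro card_mono) auto
        then show ?case by simp
      next
        case (Suc j)
        then show ?case using doubling[of j] by simp
      qed
      then have "2 ^ Suc m \<le> card (B (Suc m))" by blast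
      also have "\<dots> \<le> card T" using finB psubset.hyps by (intro card_mono) auto
      also have "\<dots> \<le> 2 ^ m" by fact
      finally show False by simp
    qed
    then obtain j where j: "j \<le> m" "card (B (Suc j)) \<le> 2 * card (B j)" by blast
    have "T - B j \<subset> T" using a aB by blast
    moreover have "card (T - B j) \<le> 2 ^ m"
      using card_mono[of T "T - B j"] psubset by force
    ultimately obtain U where U: "U \<subseteq> (T - B j) \<times> (T - B j)" "card U \<le> 2 * card (T - B j)"
        "\<And>u v. (u, v) \<in> U \<Longrightarrow> \<rho> u v \<le> (real m + 1) * c"
        "\<And>s t. s \<in> T - B j \<Longrightarrow> t \<in> T - B j \<Longrightarrow> \<rho> s t \<le> c \<Longrightarrow> \<exists>u. (u, s) \<in> U \<and> (u, t) \<in> U"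
      using psubset.IH[of "T - B j"] psubset.prems by blast
    let ?U = "U \<union> {a} \<times> B (Suc j)"
    have neighbour: "t \<in> B (Suc j)" if "s \<in> B j" "t \<in> T" "\<rho> s t \<le> c" for s t
    proof -
      have "\<rho> a t \<le> \<rho> a s + \<rho> s t"
        using a that psubset.prems by (intro triangle) (auto simp: B_def)
      then show ?thesis using that by (auto simp: B_def algebra_simps)
    qed
    have mono: "B j \<subseteq> B (Suc j)"
      using \<open>0 \<le> c\<close> by (auto simp: B_def algebra_simps)
    show ?thesis
    proof (intro exI[of _ ?U] conjI)
      show "?U \<subseteq> T \<times> T" using U(1) a finB by blast
      have "card ?U \<le> card U + card ({a} \<times> B (Suc j))" by (rule card_Un_le)
      also have "\<dots> \<le> 2 * card (T - B j) + 2 * card (B j)"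
        using U(2) j(2) by (simp add: card_cartesian_product)
      also have "\<dots> = 2 * card T"
        using finB(1)[of j] finB(2)[of j] card_mono[OF psubset.hyps(1) finB(2)[of j]]
        by (simp add: card_Diff_subset)
      finally show "card ?U \<le> 2 * card T" .
      have "real (Suc j) * c \<le> (real m + 1) * c"
        using j \<open>0 \<le> c\<close> by (intro mult_right_mono) auto
      then show "\<forall>(u, v)\<in>?U. \<rho> u v \<le> (real m + 1) * c"
        using U(3) by (auto simp: B_def)
      show "\<forall>s\<in>T. \<forall>t\<in>T. \<rho> s t \<le> c \<longrightarrow> (\<exists>u. (u, s) \<in> ?U \<and> (u, t) \<in> ?U)"
      proof (intro ballI impI)
        fix s t assume st: "s \<in> T" "t \<in> T" "\<rho> s t \<le> c"
        consider "s \<in> B j" | "t \<in> B j" | "s \<in> T - B j" "t \<in> T - B j" using st by blast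
        then show "\<exists>u. (u, s) \<in> ?U \<and> (u, t) \<in> ?U"
        proof cases
          case 1 then show ?thesis using neighbour[of s t] st mono by blast
        next
          case 2 then show ?thesis using neighbour[of t s] st mono commute[of s t] by auto
        next
          case 3 then show ?thesis using U(4)[of s t] st by blast
        qed
      qed
    qed
  qed
qed

text \<open>The explicit rate is used twice: for chaining in the state space of the process, and for
following a function along an infinite word of the fractal.\<close>

lemma geometric_steps_convergent:
  fixes a :: "nat \<Rightarrow> 'e::complete_space" and B \<theta> :: real
  assumes step: "\<And>n. dist (a n) (a (Suc n)) \<le> B * \<theta> ^ n" and "0 \<le> \<theta>" "\<theta> < 1"
  shows "convergent a" and "dist (a n) (lim a) \<le> B / (1 - \<theta>) * \<theta> ^ n"
proof -
  have "0 \<le> B" using order_trans[OF zero_le_dist step[of 0]] by simp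
  have partial: "dist (a n) (a (n + k)) \<le> B / (1 - \<theta>) * \<theta> ^ n * (1 - \<theta> ^ k)" for n k
  proof (induction k)
    case (Suc k)
    have "dist (a n) (a (n + Suc k)) \<le> dist (a n) (a (n + k)) + B * \<theta> ^ (n + k)"
      using dist_triangle[of "a n" "a (n + Suc k)" "a (n + k)"] step[of "n + k"] by simp
    also have "\<dots> \<le> B / (1 - \<theta>) * \<theta> ^ n * (1 - \<theta> ^ k) + B * \<theta> ^ (n + k)" using Suc by simp
    also have "\<dots> = B / (1 - \<theta>) * \<theta> ^ n * (1 - \<theta> ^ Suc k)"
      using \<open>\<theta> < 1\<close> by (simp add: field_simps power_add)
    finally show ?case .
  qed simp
  have bound: "dist (a n) (a m) \<le> B / (1 - \<theta>) * \<theta> ^ n" if "n \<le> m" for n m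
  proof -
    have "B / (1 - \<theta>) * \<theta> ^ n * (1 - \<theta> ^ (m - n)) \<le> B / (1 - \<theta>) * \<theta> ^ n * 1"
      using \<open>0 \<le> B\<close> assms(2,3) by (intro mult_left_mono) (auto simp: power_le_one)
    then show ?thesis using partial[of n "m - n"] that by simp
  qed
  have tail: "(\<lambda>n. B / (1 - \<theta>) * \<theta> ^ n) \<longlonglongrightarrow> 0"
    using assms(2,3) by (intro tendsto_mult_right_zero LIMSEQ_realpow_zero) auto
  have "Cauchy a"
  proof (rule metric_CauchyI)
    fix e :: real assume "e > 0"
    then obtain N where N: "B / (1 - \<theta>) * \<theta> ^ N < e / 2"
      using order_tendstoD(2)[OF tail, of "e / 2"] by (auto simp: eventually_sequentially)
    have "dist (a m) (a n) < e" if "m \<ge> N" "n \<ge> N" for m n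
      using bound[OF that(1)] bound[OF that(2)] N dist_triangle3[of "a m" "a n" "a N"]
      by linarith
    then show "\<exists>N. \<forall>m\<ge>N. \<forall>n\<ge>N. dist (a m) (a n) < e" by blast
  qed
  then show conv: "convergent a" by (simp add: Cauchy_convergent_iff)
  then have "(\<lambda>m. dist (a n) (a m)) \<longlonglongrightarrow> dist (a n) (lim a)"
    by (intro tendsto_intros) (simp add: convergent_LIMSEQ_iff)
  then show "dist (a n) (lim a) \<le> B / (1 - \<theta>) * \<theta> ^ n"
    by (rule Lim_bounded) (use bound in blast)
qed

lemma half_power_powr: "((1/2) ^ k) powr g = (2 powr - g) ^ k" for g :: real
proof -
  have "((1/2) ^ k) powr g = (1/2) powr (real k * g)"
    by (subst powr_realpow[symmetric]) (simp_all add: powr_powr)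
  also have "\<dots> = 2 powr (- g * real k)" by (simp only: powr_divide minus_mult_left[symmetric] powr_minus_divide mult.commute[of "real k"]) simp
  also have "\<dots> = (2 powr - g) ^ k" by (simp add: powr_power mult.commute)
  finally show ?thesis .
qed

lemma dyadic_scale:
  fixes s :: real
  assumes "0 < s" "s \<le> 1"
  obtains n :: nat where "(1/2) ^ Suc n < s" "s \<le> (1/2) ^ n"
proof -
  obtain k where k: "(1/2::real) ^ k < s" using real_arch_pow_inv[OF assms(1), of "1/2"] by auto
  define m where "m = (LEAST k. (1/2::real) ^ k < s)"
  have m: "(1/2::real) ^ m < s" unfolding m_def by (rule LeastI[of _ k]) (rule k)
  have "m \<noteq> 0" using m assms by (intro notI) simp
  then obtain n where n: "m = Suc n" by (cases m) auto
  then have "\<not> (1/2::real) ^ n < s" unfolding m_def using not_less_Least by (metis lessI)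
  then show ?thesis using that[of n] m n by simp
qed

text \<open>Deterministic chaining. Two points at distance about \<open>2 ^ (- n)\<close> are compared through their
approximations in the net of level \<open>n\<close>, and each point is compared with its own approximation by
a geometric series. The slack 4 in the assumption covers both kinds of pairs that occur: the
approximations of one point in consecutive nets and those of two close points in the same
net.\<close>

lemma hoelder_limit_of_chaining:
  fixes X :: "'a \<Rightarrow> 'e::complete_space" and \<rho> :: "'a \<Rightarrow> 'a \<Rightarrow> real"
  assumes "Metric_space S \<rho>" and diam: "\<And>x y. x \<in> S \<Longrightarrow> y \<in> S \<Longrightarrow> \<rho> x y \<le> 1"
    and D: "\<And>n. D n \<subseteq> S" "\<And>n. D n \<subseteq> D (Suc n)"
    and p: "\<And>n x. x \<in> S \<Longrightarrow> p n x \<in> D n" "\<And>n x. x \<in> S \<Longrightarrow> \<rho> x (p n x) \<le> (1/2) ^ n"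
    and "0 < g"
    and step: "\<And>n u v. u \<in> D n \<Longrightarrow> v \<in> D n \<Longrightarrow> \<rho> u v \<le> 4 * (1/2) ^ n \<Longrightarrow>
                 dist (X u) (X v) \<le> B * (2 powr - g) ^ n"
  shows "\<And>x. x \<in> S \<Longrightarrow> convergent (\<lambda>n. X (p n x))"
    and "\<exists>c. \<forall>x\<in>S. \<forall>y\<in>S.
           dist (lim (\<lambda>n. X (p n x))) (lim (\<lambda>n. X (p n y))) \<le> c * \<rho> x y powr g"
proof -
  interpret Metric_space S \<rho> by fact
  define \<theta> :: real where "\<theta> = 2 powr - g"
  have \<theta>: "0 < \<theta>" "\<theta> < 1" using \<open>0 < g\<close> by (auto simp: \<theta>_def powr_minus field_simps)
  have inS: "p n x \<in> S" if "x \<in> S" for n x using p(1)[OF that] D(1) by blast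
  have link: "dist (X (p n x)) (X (p (Suc n) x)) \<le> B * \<theta> * \<theta> ^ n" if "x \<in> S" for n x
  proof -
    have "\<rho> (p n x) (p (Suc n) x) \<le> \<rho> (p n x) x + \<rho> x (p (Suc n) x)"
      using that inS by (intro triangle) auto
    also have "\<dots> \<le> (1/2) ^ n + (1/2) ^ Suc n"
      using p(2)[OF that, of n] p(2)[OF that, of "Suc n"] commute[of x "p n x"] by simp
    finally have "\<rho> (p n x) (p (Suc n) x) \<le> 4 * (1/2) ^ Suc n" by (simp add: field_simps)
    from step[OF _ p(1)[OF that] this] p(1)[OF that, of n] D(2)[of n]
    show ?thesis by (auto simp: \<theta>_def mult_ac)
  qed
  note conv = geometric_steps_convergent[OF link less_imp_le[OF \<theta>(1)] \<theta>(2)]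
  show "convergent (\<lambda>n. X (p n x))" if "x \<in> S" for x using conv(1)[OF that] .
  define \<eta> where "\<eta> x = lim (\<lambda>n. X (p n x))" for x
  define K where "K = 2 * (B * \<theta> / (1 - \<theta>)) + B"
  \<comment> \<open>Two points at distance \<open>2 ^ (- n)\<close>: move to the net, across, and back.\<close>
  have same_scale: "dist (\<eta> x) (\<eta> y) \<le> K * \<theta> ^ n"
    if xy: "x \<in> S" "y \<in> S" "\<rho> x y \<le> (1/2) ^ n" for x y n
  proof -
    have "\<rho> (p n x) (p n y) \<le> \<rho> (p n x) x + (\<rho> x y + \<rho> y (p n y))"
      using xy inS triangle[of "p n x" x "p n y"] triangle[of x y "p n y"] by simp
    also have "\<dots> \<le> 4 * (1/2) ^ n"
      using p(2)[OF xy(1), of n] p(2)[OF xy(2), of n] xy(3) commute[of x "p n x"] 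
      zero_le_power[of "1/2::real" n] by linarith
    finally have "dist (X (p n x)) (X (p n y)) \<le> B * \<theta> ^ n"
      unfolding \<theta>_def by (intro step p xy)
    moreover have "dist (X (p n x)) (\<eta> x) \<le> B * \<theta> / (1 - \<theta>) * \<theta> ^ n"
      "dist (X (p n y)) (\<eta> y) \<le> B * \<theta> / (1 - \<theta>) * \<theta> ^ n"
      unfolding \<eta>_def by (intro conv(2) xy)+
    moreover have "dist (\<eta> x) (\<eta> y) \<le>
        dist (X (p n x)) (\<eta> x) + (dist (X (p n x)) (X (p n y)) + dist (X (p n y)) (\<eta> y))"
      using dist_triangle[of "\<eta> x" "\<eta> y" "X (p n x)"] dist_triangle[of "X (p n x)" "\<eta> y" "X (p n y)"]
      by (simp add: dist_commute)
    ultimately have "dist (\<eta> x) (\<eta> y) \<le> 2 * (B * \<theta> / (1 - \<theta>) * \<theta> ^ n) + B * \<theta> ^ n"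
      by linarith
    also have "\<dots> = K * \<theta> ^ n" unfolding K_def by (simp only: distrib_right mult.assoc)
    finally show ?thesis .
  qed
  have "dist (\<eta> x) (\<eta> y) \<le> (\<bar>K\<bar> / \<theta>) * \<rho> x y powr g" if xy: "x \<in> S" "y \<in> S" for x y
  proof (cases "x = y")
    case True
    then show ?thesis using xy \<theta> by simp
  next
    case False
    then have pos: "0 < \<rho> x y" using xy by (simp add: order_less_le)
    obtain n where n: "(1/2) ^ Suc n < \<rho> x y" "\<rho> x y \<le> (1/2) ^ n"
      using dyadic_scale[OF pos diam[OF xy]] .
    have "\<theta> ^ Suc n = ((1/2) ^ Suc n) powr g"
      by (simp only: \<theta>_def half_power_powr)
    also have "\<dots> \<le> \<rho> x y powr g" using n \<open>0 < g\<close> by (intro powr_mono2) auto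
    finally have scale: "\<theta> ^ n \<le> \<rho> x y powr g / \<theta>" using \<theta> by (simp add: field_simps)
    have "dist (\<eta> x) (\<eta> y) \<le> K * \<theta> ^ n" by (intro same_scale xy n)
    also have "\<dots> \<le> \<bar>K\<bar> * \<theta> ^ n" using \<theta> by (intro mult_right_mono) auto
    also have "\<dots> \<le> \<bar>K\<bar> * (\<rho> x y powr g / \<theta>)" using scale by (intro mult_left_mono) auto
    finally show ?thesis by simp
  qed
  then show "\<exists>c. \<forall>x\<in>S. \<forall>y\<in>S.
           dist (lim (\<lambda>n. X (p n x))) (lim (\<lambda>n. X (p n y))) \<le> c * \<rho> x y powr g"
    unfolding \<eta>_def by blast
qed

lemma poly_times_geometric_bounded:
  fixes k a :: real
  assumes "0 < a"
  shows "\<exists>K. \<forall>n::nat. real (Suc n) powr k * 2 powr (- a * real n) \<le> K"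
proof -
  have "(\<lambda>n::nat. real (Suc n) powr k * 2 powr (- a * real n)) \<longlonglongrightarrow> 0"
    using assms by real_asymp
  then have "Bseq (\<lambda>n::nat. real (Suc n) powr k * 2 powr (- a * real n))"
    by (rule convergent_imp_Bseq[OF convergentI])
  then obtain K where "\<forall>n. norm (real (Suc n) powr k * 2 powr (- a * real n)) \<le> K"
    by (auto simp: Bseq_def)
  then show ?thesis by (intro exI[of _ K]) auto
qed

text \<open>Nested nets make the link between consecutive levels a pair inside one net; taking the union of
the first levels costs a factor \<open>n + 1\<close>, which is harmless here. The net of level \<open>n\<close> has at most
\<open>2 ^ (a * (n + 1))\<close> points for a suitable \<open>a\<close>, so the logarithm lost in \<open>sparse_pairs\<close> is linear in
the level.\<close>

lemma nets_with_sparse_close_pairs: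
  fixes \<rho> :: "'a \<Rightarrow> 'a \<Rightarrow> real" and N t :: real
  assumes "Metric_space S \<rho>" and "0 \<le> t"
    and nets: "\<And>n. \<exists>D\<subseteq>S. finite D \<and> card D \<le> N * 2 powr (t * real n) \<and>
                       (\<forall>x\<in>S. \<exists>u\<in>D. \<rho> x u \<le> (1/2) ^ n)"
  obtains D U :: "nat \<Rightarrow> _" and L :: real where
    "\<And>n. D n \<subseteq> S" "\<And>n. D n \<subseteq> D (Suc n)" "\<And>n x. x \<in> S \<Longrightarrow> \<exists>u\<in>D n. \<rho> x u \<le> (1/2) ^ n"
    "\<And>n. finite (U n)" "\<And>n. U n \<subseteq> D n \<times> D n"
    "\<And>n. real (card (U n)) \<le> L * real (Suc n) * 2 powr (t * real n)"
    "\<And>n u v. (u, v) \<in> U n \<Longrightarrow> \<rho> u v \<le> L * real (Suc n) * (1/2) ^ n"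
    "\<And>n s t. s \<in> D n \<Longrightarrow> t \<in> D n \<Longrightarrow> \<rho> s t \<le> 4 * (1/2) ^ n \<Longrightarrow>
        \<exists>u. (u, s) \<in> U n \<and> (u, t) \<in> U n"
    "0 \<le> L"
proof -
  obtain D0 where D0: "\<And>n. D0 n \<subseteq> S" "\<And>n. finite (D0 n)"
      "\<And>n. card (D0 n) \<le> N * 2 powr (t * real n)"
      "\<And>n x. x \<in> S \<Longrightarrow> \<exists>u\<in>D0 n. \<rho> x u \<le> (1/2) ^ n"
    using nets by metis
  have "0 \<le> N" using order_trans[OF of_nat_0_le_iff D0(3)[of 0]] by simp
  define D where "D n = (\<Union>k\<le>n. D0 k)" for n
  have finD: "finite (D n)" for n using D0(2) by (auto simp: D_def)
  have cardD: "real (card (D n)) \<le> real (Suc n) * (N * 2 powr (t * real n))" for n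
  proof -
    have "real (card (D n)) \<le> (\<Sum>k\<le>n. real (card (D0 k)))"
      unfolding D_def of_nat_sum[symmetric] by (intro of_nat_mono card_UN_le) auto
    also have "\<dots> \<le> (\<Sum>k\<le>n. N * 2 powr (t * real n))"
      using \<open>0 \<le> N\<close> \<open>0 \<le> t\<close>
      by (intro sum_mono order_trans[OF D0(3)] mult_left_mono powr_mono) auto
    finally show ?thesis by simp
  qed
  define a :: nat where "a = Suc (nat \<lceil>N\<rceil> + nat \<lceil>t\<rceil>)"
  have cardD2: "card (D n) \<le> 2 ^ (a * Suc n)" for n
  proof -
    have "real (Suc n) \<le> 2 powr real n" 
      using of_nat_mono[OF Suc_leI[OF less_exp[of n]], where 'a=real] by (simp add: powr_realpow)
    moreover have "N \<le> 2 powr (nat \<lceil>N\<rceil>)"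
    proof -
      have "N \<le> real (nat \<lceil>N\<rceil>)" by linarith
      also have "\<dots> \<le> real (2 ^ nat \<lceil>N\<rceil>)" by (intro of_nat_mono less_imp_le[OF less_exp])
      finally show ?thesis by (simp add: powr_realpow)
    qed
    moreover have "2 powr (t * real n) \<le> 2 powr (nat \<lceil>t\<rceil> * real n)"
      by (intro powr_mono mult_right_mono) linarith+
    ultimately have "real (Suc n) * (N * 2 powr (t * real n))
        \<le> 2 powr real n * (2 powr (nat \<lceil>N\<rceil>) * 2 powr (nat \<lceil>t\<rceil> * real n))"
      using \<open>0 \<le> N\<close> by (intro mult_mono) auto
    also have "\<dots> = 2 powr (real n + (nat \<lceil>N\<rceil> + nat \<lceil>t\<rceil> * real n))"
      by (simp add: powr_add)
    also have "\<dots> \<le> 2 powr (real (a * Suc n))"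
      unfolding a_def by (intro powr_mono) (simp_all add: algebra_simps)
    finally have "real (card (D n)) \<le> 2 powr (real (a * Suc n))" using cardD[of n] by simp
    also have "\<dots> = real (2 ^ (a * Suc n))" by (simp only: powr_realpow[of 2] of_nat_power) simp
    finally show ?thesis by linarith
  qed
  have "\<exists>U. U \<subseteq> D n \<times> D n \<and> card U \<le> 2 * card (D n) \<and>
      (\<forall>(u, v)\<in>U. \<rho> u v \<le> (real (a * Suc n) + 1) * (4 * (1/2) ^ n)) \<and>
      (\<forall>s\<in>D n. \<forall>t\<in>D n. \<rho> s t \<le> 4 * (1/2) ^ n \<longrightarrow> (\<exists>u. (u, s) \<in> U \<and> (u, t) \<in> U))" for n
    using D0(1) by (intro sparse_pairs[OF assms(1) finD] cardD2) (auto simp: D_def)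
  then have "\<forall>n. \<exists>U. U \<subseteq> D n \<times> D n \<and> card U \<le> 2 * card (D n) \<and>
      (\<forall>(u, v)\<in>U. \<rho> u v \<le> (real (a * Suc n) + 1) * (4 * (1/2) ^ n)) \<and>
      (\<forall>s\<in>D n. \<forall>t\<in>D n. \<rho> s t \<le> 4 * (1/2) ^ n \<longrightarrow> (\<exists>u. (u, s) \<in> U \<and> (u, t) \<in> U))"
    by blast
  from choice[OF this] obtain U where U0: "\<forall>n. U n \<subseteq> D n \<times> D n \<and> card (U n) \<le> 2 * card (D n) \<and>
      (\<forall>(u, v)\<in>U n. \<rho> u v \<le> (real (a * Suc n) + 1) * (4 * (1/2) ^ n)) \<and>
      (\<forall>s\<in>D n. \<forall>t\<in>D n. \<rho> s t \<le> 4 * (1/2) ^ n \<longrightarrow> (\<exists>u. (u, s) \<in> U n \<and> (u, t) \<in> U n))" ..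
  have U: "\<And>n. U n \<subseteq> D n \<times> D n" "\<And>n. card (U n) \<le> 2 * card (D n)"
      "\<And>n u v. (u, v) \<in> U n \<Longrightarrow> \<rho> u v \<le> (real (a * Suc n) + 1) * (4 * (1/2) ^ n)"
      "\<And>n s t. s \<in> D n \<Longrightarrow> t \<in> D n \<Longrightarrow> \<rho> s t \<le> 4 * (1/2) ^ n \<Longrightarrow> \<exists>u. (u, s) \<in> U n \<and> (u, t) \<in> U n"
    using U0 by blast+
  define L where "L = max (2 * N) (4 * (real a + 1))"
  show ?thesis
  proof (rule that[of D U L])
    show "D n \<subseteq> S" for n using D0(1) by (auto simp: D_def)
    show "D n \<subseteq> D (Suc n)" for n unfolding D_def by (intro UN_mono) auto
    show "\<exists>u\<in>D n. \<rho> x u \<le> (1/2) ^ n" if "x \<in> S" for n x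
      using D0(4)[OF that, of n] by (auto simp: D_def)
    show "finite (U n)" for n using finite_subset[OF U(1)] finD by blast
    show "real (card (U n)) \<le> L * real (Suc n) * 2 powr (t * real n)" for n
    proof -
      have "real (card (U n)) \<le> 2 * real (card (D n))" using U(2)[of n] by linarith
      also have "\<dots> \<le> (2 * N) * (real (Suc n) * 2 powr (t * real n))" using cardD[of n] by (simp add: mult_ac)
      also have "\<dots> \<le> L * (real (Suc n) * 2 powr (t * real n))"
        by (intro mult_right_mono) (auto simp: L_def)
      finally show ?thesis by (simp add: mult_ac)
    qed
    show "\<rho> u v \<le> L * real (Suc n) * (1/2) ^ n" if "(u, v) \<in> U n" for n u v
    proof -
      have "(real (a * Suc n) + 1) * (4 * (1/2) ^ n) \<le> (4 * (real a + 1)) * (real (Suc n) * (1/2) ^ n)"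
        by (simp add: algebra_simps)
      also have "\<dots> \<le> L * (real (Suc n) * (1/2) ^ n)" by (intro mult_right_mono) (auto simp: L_def)
      finally have "(real (a * Suc n) + 1) * (4 * (1/2) ^ n) \<le> L * real (Suc n) * (1/2) ^ n"
        by (simp only: mult.assoc)
      with U(3)[OF that] show ?thesis by (rule order_trans)
    qed
    show "0 \<le> L" by (simp add: L_def le_max_iff_disj)
    show "U n \<subseteq> D n \<times> D n" for n by (rule U(1))
    show "\<exists>u. (u, s) \<in> U n \<and> (u, t) \<in> U n"
      if "s \<in> D n" "t \<in> D n" "\<rho> s t \<le> 4 * (1/2) ^ n" for n s t
      using that by (rule U(4))
  qed
qed

lemma AE_LIMSEQ_of_summable_moments:
  fixes Y :: "nat \<Rightarrow> 'w \<Rightarrow> 'e::polish_space" and X :: "'w \<Rightarrow> 'e"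
  assumes [measurable]: "\<And>n. Y n \<in> borel_measurable \<Omega>" "X \<in> borel_measurable \<Omega>" and "0 < \<beta>"
    and moment: "\<And>n. (\<integral>\<^sup>+\<omega>. ennreal (dist (Y n \<omega>) (X \<omega>) powr \<beta>) \<partial>\<Omega>) \<le> ennreal (m n)"
    and m: "summable m" "\<And>n. 0 \<le> m n"
  shows "AE \<omega> in \<Omega>. (\<lambda>n. Y n \<omega>) \<longlonglongrightarrow> X \<omega>"
proof -
  have "(\<integral>\<^sup>+\<omega>. (\<Sum>n. ennreal (dist (Y n \<omega>) (X \<omega>) powr \<beta>)) \<partial>\<Omega>)
      = (\<Sum>n. \<integral>\<^sup>+\<omega>. ennreal (dist (Y n \<omega>) (X \<omega>) powr \<beta>) \<partial>\<Omega>)"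
    by (rule nn_integral_suminf) measurable
  also have "\<dots> \<le> (\<Sum>n. ennreal (m n))" by (intro suminf_le moment) auto
  also have "\<dots> < \<infinity>" using m by (simp add: suminf_ennreal2)
  finally have "AE \<omega> in \<Omega>. (\<Sum>n. ennreal (dist (Y n \<omega>) (X \<omega>) powr \<beta>)) \<noteq> \<infinity>"
    by (intro nn_integral_PInf_AE) auto
  then show ?thesis
  proof (eventually_elim)
    case (elim \<omega>)
    then have "summable (\<lambda>n. dist (Y n \<omega>) (X \<omega>) powr \<beta>)"
      by (intro summable_suminf_not_top) auto
    then have "(\<lambda>n. dist (Y n \<omega>) (X \<omega>) powr \<beta>) \<longlonglongrightarrow> 0" by (rule summable_LIMSEQ_zero)
    then have "(\<lambda>n. (dist (Y n \<omega>) (X \<omega>) powr \<beta>) powr (1 / \<beta>)) \<longlonglongrightarrow> 0 powr (1 / \<beta>)"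
      using \<open>0 < \<beta>\<close> by (intro tendsto_powr2 tendsto_const) (auto intro!: always_eventually)
    then show ?case using \<open>0 < \<beta>\<close> by (subst tendsto_dist_iff) (simp add: powr_powr)
  qed
qed

text \<open>A single random variable \<open>Z\<close>, the sum of all selected increments to the power \<open>\<beta>\<close> with suitable
weights, has finite expectation. Where it is finite, it bounds every selected increment at every
level at once, with the critical exponent \<open>\<delta>\<close> up to a polynomial factor in the level. One event of
full measure therefore serves all exponents below \<open>\<delta>\<close>.\<close>

theorem kolmogorov_continuity_entropy:
  fixes \<xi> :: "'a \<Rightarrow> 'w \<Rightarrow> 'e::polish_space" and \<rho> :: "'a \<Rightarrow> 'a \<Rightarrow> real" and C N t \<beta> \<delta> :: real
  assumes "Metric_space S \<rho>" and diam: "\<And>x y. x \<in> S \<Longrightarrow> y \<in> S \<Longrightarrow> \<rho> x y \<le> 1"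
    and nets: "\<And>n. \<exists>D\<subseteq>S. finite D \<and> card D \<le> N * 2 powr (t * real n) \<and>
                       (\<forall>x\<in>S. \<exists>u\<in>D. \<rho> x u \<le> (1/2) ^ n)"
    and "0 \<le> t" "0 < \<beta>" "0 < \<delta>" "0 \<le> C"
    and meas: "\<And>x. x \<in> S \<Longrightarrow> \<xi> x \<in> borel_measurable \<Omega>"
    and moment: "\<And>x y. x \<in> S \<Longrightarrow> y \<in> S \<Longrightarrow>
           (\<integral>\<^sup>+\<omega>. ennreal (dist (\<xi> x \<omega>) (\<xi> y \<omega>) powr \<beta>) \<partial>\<Omega>)
             \<le> ennreal (C * \<rho> x y powr (t + \<delta> * \<beta>))"
  shows "\<exists>\<eta>. (\<forall>x\<in>S. \<eta> x \<in> borel_measurable \<Omega> \<and> (AE \<omega> in \<Omega>. \<eta> x \<omega> = \<xi> x \<omega>)) \<and>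
             (AE \<omega> in \<Omega>. \<forall>g. 0 < g \<and> g < \<delta> \<longrightarrow>
                (\<exists>c. \<forall>x\<in>S. \<forall>y\<in>S. dist (\<eta> x \<omega>) (\<eta> y \<omega>) \<le> c * \<rho> x y powr g))"
proof -
  interpret Metric_space S \<rho> by fact
  obtain D U L where D: "\<And>n. D n \<subseteq> S" "\<And>n. D n \<subseteq> D (Suc n)"
      "\<And>n x. x \<in> S \<Longrightarrow> \<exists>u\<in>D n. \<rho> x u \<le> (1/2) ^ n"
    and U: "\<And>n. finite (U n)" "\<And>n. U n \<subseteq> D n \<times> D n"
      "\<And>n. real (card (U n)) \<le> L * real (Suc n) * 2 powr (t * real n)"
      "\<And>n u v. (u, v) \<in> U n \<Longrightarrow> \<rho> u v \<le> L * real (Suc n) * (1/2) ^ n"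
      "\<And>n s t. s \<in> D n \<Longrightarrow> t \<in> D n \<Longrightarrow> \<rho> s t \<le> 4 * (1/2) ^ n \<Longrightarrow>
        \<exists>u. (u, s) \<in> U n \<and> (u, t) \<in> U n"
    and "0 \<le> L"
    using nets_with_sparse_close_pairs[OF assms(1) \<open>0 \<le> t\<close> nets] by blast
  obtain p where p: "\<And>n x. x \<in> S \<Longrightarrow> p n x \<in> D n" "\<And>n x. x \<in> S \<Longrightarrow> \<rho> x (p n x) \<le> (1/2) ^ n"
  proof
    define p where "p n x = (SOME u. u \<in> D n \<and> \<rho> x u \<le> (1/2) ^ n)" for n x
    have "p n x \<in> D n \<and> \<rho> x (p n x) \<le> (1/2) ^ n" if "x \<in> S" for n x
      unfolding p_def by (rule someI_ex) (use D(3)[OF that, of n] in blast)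
    then show "\<And>n x. x \<in> S \<Longrightarrow> p n x \<in> D n" "\<And>n x. x \<in> S \<Longrightarrow> \<rho> x (p n x) \<le> (1/2) ^ n" by auto
  qed
  have pS: "p n x \<in> S" if "x \<in> S" for n x using p(1)[OF that] D(1) by blast
  have US: "u \<in> S" "v \<in> S" if "(u, v) \<in> U n" for u v n using that U(2) D(1) by blast+
  define q where "q = t + \<delta> * \<beta>"
  have "0 < q" using assms by (simp add: q_def add_nonneg_pos)
  \<comment> \<open>The exponential part cancels the expected size of level \<open>n\<close> exactly; in the polynomial part,
     \<open>q + 1\<close> powers cancel the losses of \<open>sparse_pairs\<close> and two more make the series converge.\<close>
  define b where "b n = 2 powr (\<delta> * \<beta> * real n) * real (Suc n) powr (- (q + 3))" for n
  have b: "0 < b n" for n by (simp add: b_def)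
  define Z where "Z \<omega> = (\<Sum>n. \<Sum>(u, v)\<in>U n. ennreal (b n * dist (\<xi> u \<omega>) (\<xi> v \<omega>) powr \<beta>))" for \<omega>
  have measU: "(\<lambda>\<omega>. ennreal (b n * dist (\<xi> (fst e) \<omega>) (\<xi> (snd e) \<omega>) powr \<beta>)) \<in> borel_measurable \<Omega>"
    if "e \<in> U n" for n e
  proof -
    have [measurable]: "\<xi> (fst e) \<in> borel_measurable \<Omega>" "\<xi> (snd e) \<in> borel_measurable \<Omega>"
      using meas US[of "fst e" "snd e" n] that by auto
    show ?thesis by measurable
  qed
  have Z_meas [measurable]: "Z \<in> borel_measurable \<Omega>"
    unfolding Z_def case_prod_unfold using measU by (intro borel_measurable_suminf_order borel_measurable_sum)
  define K where "K = L * C * L powr q"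
  have level: "(\<integral>\<^sup>+\<omega>. (\<Sum>(u, v)\<in>U n. ennreal (b n * dist (\<xi> u \<omega>) (\<xi> v \<omega>) powr \<beta>)) \<partial>\<Omega>)
      \<le> ennreal (K * real (Suc n) powr (- 2))" for n
  proof -
    have pair: "(\<integral>\<^sup>+\<omega>. ennreal (b n * dist (\<xi> (fst e) \<omega>) (\<xi> (snd e) \<omega>) powr \<beta>) \<partial>\<Omega>)
        \<le> ennreal (b n * (C * (L * real (Suc n) * (1/2) ^ n) powr q))" if e: "e \<in> U n" for e
    proof -
      have [measurable]: "\<xi> (fst e) \<in> borel_measurable \<Omega>" "\<xi> (snd e) \<in> borel_measurable \<Omega>"
        using meas US[of "fst e" "snd e" n] that by auto
      have "(\<integral>\<^sup>+\<omega>. ennreal (b n * dist (\<xi> (fst e) \<omega>) (\<xi> (snd e) \<omega>) powr \<beta>) \<partial>\<Omega>)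
          = ennreal (b n) * (\<integral>\<^sup>+\<omega>. ennreal (dist (\<xi> (fst e) \<omega>) (\<xi> (snd e) \<omega>) powr \<beta>) \<partial>\<Omega>)"
        using b[of n] by (subst nn_integral_cmult[symmetric]) (auto simp: ennreal_mult)
      also have "\<dots> \<le> ennreal (b n) * ennreal (C * \<rho> (fst e) (snd e) powr q)"
        unfolding q_def using US[of "fst e" "snd e" n] e by (intro mult_left_mono moment) auto
      also have "\<dots> \<le> ennreal (b n) * ennreal (C * (L * real (Suc n) * (1/2) ^ n) powr q)"
        using U(4)[of "fst e" "snd e" n] e \<open>0 \<le> C\<close> \<open>0 < q\<close>
        by (intro mult_left_mono ennreal_leI powr_mono2) auto
      also have "\<dots> = ennreal (b n * (C * (L * real (Suc n) * (1/2) ^ n) powr q))"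
        using b[of n] by (intro ennreal_mult'[symmetric]) auto
      finally show ?thesis .
    qed
    have "(\<integral>\<^sup>+\<omega>. (\<Sum>(u, v)\<in>U n. ennreal (b n * dist (\<xi> u \<omega>) (\<xi> v \<omega>) powr \<beta>)) \<partial>\<Omega>)
       = (\<Sum>e\<in>U n. \<integral>\<^sup>+\<omega>. ennreal (b n * dist (\<xi> (fst e) \<omega>) (\<xi> (snd e) \<omega>) powr \<beta>) \<partial>\<Omega>)"
      unfolding case_prod_unfold by (intro nn_integral_sum measU)
    also have "\<dots> \<le> (\<Sum>e\<in>U n. ennreal (b n * (C * (L * real (Suc n) * (1/2) ^ n) powr q)))"
      by (intro sum_mono pair)
    also have "\<dots> = ennreal (real (card (U n)) * (b n * (C * (L * real (Suc n) * (1/2) ^ n) powr q)))"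
      using b[of n] \<open>0 \<le> C\<close> by (simp add: ennreal_mult' ennreal_of_nat_eq_real_of_nat)
    also have "\<dots> \<le> ennreal ((L * real (Suc n) * 2 powr (t * real n)) *
        (b n * (C * (L * real (Suc n) * (1/2) ^ n) powr q)))"
      using b[of n] \<open>0 \<le> C\<close> by (intro ennreal_leI mult_right_mono U(3)) auto
    also have "(L * real (Suc n) * 2 powr (t * real n)) *
        (b n * (C * (L * real (Suc n) * (1/2) ^ n) powr q))
      = K * (real (Suc n) powr 1 * real (Suc n) powr (- (q + 3)) * real (Suc n) powr q) *
        (2 powr (t * real n) * 2 powr (\<delta> * \<beta> * real n) * ((1/2) ^ n) powr q)"
      using \<open>0 \<le> L\<close> by (simp add: b_def K_def powr_mult)
    also have "((1/2::real) ^ n) powr q = 2 powr (- (real n * q))"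
      by (simp add: half_power_powr powr_power mult.commute)
    also have "2 powr (t * real n) * 2 powr (\<delta> * \<beta> * real n) * 2 powr (- (real n * q)) = 1"
      by (simp add: powr_add[symmetric] q_def algebra_simps)
    also have "real (Suc n) powr 1 * real (Suc n) powr (- (q + 3)) * real (Suc n) powr q
        = real (Suc n) powr (- 2)"
      by (simp only: powr_add[symmetric]) simp
    finally show ?thesis by simp
  qed
  have sum2: "summable (\<lambda>n. K * real (Suc n) powr (- 2))"
    using summable_Suc_iff[of "\<lambda>n. real n powr - 2"] by (intro summable_mult) (simp add: summable_real_powr_iff)
  have "(\<integral>\<^sup>+\<omega>. Z \<omega> \<partial>\<Omega>) = (\<Sum>n. \<integral>\<^sup>+\<omega>. (\<Sum>(u, v)\<in>U n. ennreal (b n * dist (\<xi> u \<omega>) (\<xi> v \<omega>) powr \<beta>)) \<partial>\<Omega>)"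
    unfolding Z_def case_prod_unfold using measU by (intro nn_integral_suminf borel_measurable_sum)
  also have "\<dots> \<le> (\<Sum>n. ennreal (K * real (Suc n) powr (- 2)))" by (intro suminf_le level) auto
  also have "\<dots> < \<infinity>"
    using sum2 \<open>0 \<le> L\<close> \<open>0 \<le> C\<close> by (simp add: suminf_ennreal2 K_def)
  finally have AE_Z: "AE \<omega> in \<Omega>. Z \<omega> \<noteq> \<infinity>" by (intro nn_integral_PInf_AE) auto
  have hoelder: "(\<forall>x\<in>S. convergent (\<lambda>n. \<xi> (p n x) \<omega>)) \<and>
      (\<exists>c. \<forall>x\<in>S. \<forall>y\<in>S. dist (lim (\<lambda>n. \<xi> (p n x) \<omega>)) (lim (\<lambda>n. \<xi> (p n y) \<omega>)) \<le> c * \<rho> x y powr g)"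
    if fin: "Z \<omega> \<noteq> \<infinity>" and g: "0 < g" "g < \<delta>" for \<omega> g
  proof -
    define z where "z = enn2real (Z \<omega>)"
    have z: "b n * dist (\<xi> u \<omega>) (\<xi> v \<omega>) powr \<beta> \<le> z" if e: "(u, v) \<in> U n" for n u v
    proof -
      have "ennreal (b n * dist (\<xi> u \<omega>) (\<xi> v \<omega>) powr \<beta>)
          \<le> (\<Sum>(u, v)\<in>U n. ennreal (b n * dist (\<xi> u \<omega>) (\<xi> v \<omega>) powr \<beta>))"
        using member_le_sum[OF e, of "\<lambda>(u, v). ennreal (b n * dist (\<xi> u \<omega>) (\<xi> v \<omega>) powr \<beta>)"] U(1) by simp
      also have "\<dots> \<le> Z \<omega>" unfolding Z_def
        using sum_le_suminf[OF summableI, of "{n}" "\<lambda>n. \<Sum>(u, v)\<in>U n. ennreal (b n * dist (\<xi> u \<omega>) (\<xi> v \<omega>) powr \<beta>)"]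
        by simp
      also have "\<dots> = ennreal z" using fin by (simp add: z_def less_top)
      finally show ?thesis using b[of n] by (simp add: z_def ennreal_le_iff)
    qed
    obtain B where B: "\<And>n::nat. real (Suc n) powr ((q + 3) / \<beta>) * 2 powr (- (\<delta> - g) * real n) \<le> B"
      using poly_times_geometric_bounded[of "\<delta> - g" "(q + 3) / \<beta>"] g by auto
    have "dist (\<xi> u \<omega>) (\<xi> v \<omega>) \<le> z powr (1 / \<beta>) * B * (2 powr - g) ^ n" if e: "(u, v) \<in> U n" for n u v
    proof -
      have "dist (\<xi> u \<omega>) (\<xi> v \<omega>) powr \<beta> \<le> z / b n" using z[OF e] b[of n] by (simp add: field_simps)
      then have "(dist (\<xi> u \<omega>) (\<xi> v \<omega>) powr \<beta>) powr (1 / \<beta>) \<le> (z / b n) powr (1 / \<beta>)"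
        using \<open>0 < \<beta>\<close> by (intro powr_mono2) auto
      then have "dist (\<xi> u \<omega>) (\<xi> v \<omega>) \<le> (z / b n) powr (1 / \<beta>)"
        using \<open>0 < \<beta>\<close> by (simp add: powr_powr)
      also have "\<dots> = z powr (1 / \<beta>) * b n powr (- (1 / \<beta>))"
        using b[of n] powr_divide[of z "b n" "1 / \<beta>"] by (simp add: powr_minus_divide z_def)
      also have "b n powr (- (1 / \<beta>)) = 2 powr (- \<delta> * real n) * real (Suc n) powr ((q + 3) / \<beta>)"
      proof -
        have "\<delta> * \<beta> * real n * - (1 / \<beta>) = - \<delta> * real n" "- (q + 3) * - (1 / \<beta>) = (q + 3) / \<beta>"
          using \<open>0 < \<beta>\<close> by (auto simp: field_simps)
        then show ?thesis by (simp only: b_def powr_mult powr_powr powr_ge_zero of_nat_0_le_iff)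
      qed
      also have "2 powr (- \<delta> * real n) = 2 powr (- (\<delta> - g) * real n) * (2 powr - g) ^ n"
        by (simp add: powr_power powr_add[symmetric] algebra_simps)
      also have "z powr (1 / \<beta>) * (2 powr (- (\<delta> - g) * real n) * (2 powr - g) ^ n * real (Suc n) powr ((q + 3) / \<beta>))
          = z powr (1 / \<beta>) * (real (Suc n) powr ((q + 3) / \<beta>) * 2 powr (- (\<delta> - g) * real n)) * (2 powr - g) ^ n"
        by (simp add: mult_ac)
      also have "\<dots> \<le> z powr (1 / \<beta>) * B * (2 powr - g) ^ n"
        by (intro mult_right_mono mult_left_mono B) auto
      finally show ?thesis .
    qed
    note link = this
    have close: "dist (\<xi> s \<omega>) (\<xi> t \<omega>) \<le> 2 * (z powr (1 / \<beta>) * B) * (2 powr - g) ^ n"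
      if st: "s \<in> D n" "t \<in> D n" "\<rho> s t \<le> 4 * (1/2) ^ n" for n s t
    proof -
      obtain u where "(u, s) \<in> U n" "(u, t) \<in> U n" using U(5)[OF st] by blast
      from link[OF this(1)] link[OF this(2)] dist_triangle3[of "\<xi> s \<omega>" "\<xi> t \<omega>" "\<xi> u \<omega>"]
      show ?thesis by linarith
    qed
    show ?thesis
      using hoelder_limit_of_chaining[where X="\<lambda>x. \<xi> x \<omega>" and D=D and p=p and S=S and \<rho>=\<rho> and g=g
          and B="2 * (z powr (1 / \<beta>) * B)", OF assms(1) diam D(1,2) p g(1) close]
      by simp
  qed
  define G where "G = {\<omega> \<in> space \<Omega>. Z \<omega> \<noteq> \<infinity>}"
  have G [measurable]: "G \<in> sets \<Omega>" unfolding G_def by measurable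
  have AE_G: "AE \<omega> in \<Omega>. \<omega> \<in> G" using AE_Z AE_space by eventually_elim (simp add: G_def)
  \<comment> \<open>The limit is taken on a measurable event of full measure only, so that \<open>\<eta> x\<close> is measurable
     although the measure space need not be complete.\<close>
  define \<eta> where "\<eta> x \<omega> = (if \<omega> \<in> G then lim (\<lambda>n. \<xi> (p n x) \<omega>) else undefined)" for x \<omega>
  have "\<eta> x \<in> borel_measurable \<Omega>" if x: "x \<in> S" for x
  proof (rule borel_measurable_LIMSEQ_metric)
    have [measurable]: "\<xi> (p n x) \<in> borel_measurable \<Omega>" for n using meas pS x by blast
    show "(\<lambda>\<omega>. if \<omega> \<in> G then \<xi> (p n x) \<omega> else undefined) \<in> borel_measurable \<Omega>" for n by measurable
    show "(\<lambda>n. if \<omega> \<in> G then \<xi> (p n x) \<omega> else undefined) \<longlonglongrightarrow> \<eta> x \<omega>" for \<omega>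
      using hoelder[of \<omega> "\<delta> / 2"] \<open>0 < \<delta>\<close> x by (auto simp: \<eta>_def G_def convergent_LIMSEQ_iff)
  qed
  moreover have "AE \<omega> in \<Omega>. \<eta> x \<omega> = \<xi> x \<omega>" if x: "x \<in> S" for x
  proof -
    have "AE \<omega> in \<Omega>. (\<lambda>n. \<xi> (p n x) \<omega>) \<longlonglongrightarrow> \<xi> x \<omega>"
    proof (rule AE_LIMSEQ_of_summable_moments[where m="\<lambda>n. C * (2 powr - q) ^ n"])
      show "\<xi> (p n x) \<in> borel_measurable \<Omega>" "\<xi> x \<in> borel_measurable \<Omega>" for n using meas pS x by blast+
      show "(\<integral>\<^sup>+\<omega>. ennreal (dist (\<xi> (p n x) \<omega>) (\<xi> x \<omega>) powr \<beta>) \<partial>\<Omega>) \<le> ennreal (C * (2 powr - q) ^ n)" for n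
      proof -
        have "\<rho> (p n x) x powr q \<le> ((1/2) ^ n) powr q"
          using p(2)[OF x, of n] \<open>0 < q\<close> by (intro powr_mono2) (auto simp: commute)
        also have "\<dots> = (2 powr - q) ^ n" by (rule half_power_powr)
        finally show ?thesis using moment[OF pS[OF x] x, of n] \<open>0 \<le> C\<close>
          by (auto simp: q_def intro!: mult_left_mono ennreal_leI elim!: order_trans)
      qed
      show "summable (\<lambda>n. C * (2 powr - q) ^ n)"
        using \<open>0 < q\<close> by (intro summable_mult summable_geometric) (simp add: powr_minus inverse_less_1_iff)
    qed (use \<open>0 < \<beta>\<close> \<open>0 \<le> C\<close> in auto)
    with AE_G show ?thesis by eventually_elim (simp add: \<eta>_def limI)
  qed
  moreover have "AE \<omega> in \<Omega>. \<forall>g. 0 < g \<and> g < \<delta> \<longrightarrow>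
                (\<exists>c. \<forall>x\<in>S. \<forall>y\<in>S. dist (\<eta> x \<omega>) (\<eta> y \<omega>) \<le> c * \<rho> x y powr g)"
    using AE_G
  proof eventually_elim
    case (elim \<omega>)
    then show ?case using hoelder[of \<omega>] by (auto simp: \<eta>_def G_def)
  qed
  ultimately show ?thesis by blast
qed

section \<open>Post-critically finite sets and their coding\<close>

locale pcf_set =
  fixes M :: nat and F :: "'a::metric_space set" and \<psi> :: "nat \<Rightarrow> 'a \<Rightarrow> 'a"
  assumes pcf: "connected_pcf_set M F \<psi>"
begin

abbreviation "I \<equiv> {1..M}"
abbreviation "V \<equiv> boundary0 M F \<psi>"
abbreviation cmp where "cmp \<equiv> comp_word \<psi>"
abbreviation prefix :: "(nat \<Rightarrow> nat) \<Rightarrow> nat \<Rightarrow> nat list" where "prefix w n \<equiv> map w [0..<n]"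

lemma pcf_facts: "2 \<le> M" "F \<noteq> {}" "compact F" "connected F" "F = (\<Union>i\<in>I. \<psi> i ` F)"
    "finite (post_critical M F \<psi>)"
  using pcf unfolding connected_pcf_set_def by auto

lemma inj_\<psi>: "i \<in> I \<Longrightarrow> inj_on (\<psi> i) F"
  using pcf unfolding connected_pcf_set_def by auto

lemma \<psi>_in: "i \<in> I \<Longrightarrow> x \<in> F \<Longrightarrow> \<psi> i x \<in> F"
  using pcf_facts(5) by blast

lemma cell_cover: assumes "x \<in> F" obtains i y where "i \<in> I" "y \<in> F" "x = \<psi> i y"
  using assms pcf_facts(5) by blast

lemma cmp_in: "set w \<subseteq> I \<Longrightarrow> x \<in> F \<Longrightarrow> cmp w x \<in> F"
  by (induction w) (auto intro: \<psi>_in)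

lemma cmp_append: "cmp (u @ v) x = cmp u (cmp v x)"
  by (induction u) auto

lemma contraction:
  obtains L where "0 \<le> L" "L < 1"
    "\<And>w x y. set w \<subseteq> I \<Longrightarrow> x \<in> F \<Longrightarrow> y \<in> F \<Longrightarrow> dist (cmp w x) (cmp w y) \<le> L ^ length w * dist x y"
proof -
  have "\<forall>i\<in>I. \<exists>L. L < 1 \<and> L-lipschitz_on F (\<psi> i)"
    using pcf unfolding connected_pcf_set_def by blast
  then obtain l where l: "\<And>i. i \<in> I \<Longrightarrow> l i < 1" "\<And>i. i \<in> I \<Longrightarrow> (l i)-lipschitz_on F (\<psi> i)" 
    by metis
  define L where "L = Max (l ` I)"
  have ne: "l ` I \<noteq> {}" using pcf_facts(1) by auto
  have L1: "L < 1" unfolding L_def using ne l by (subst Max_less_iff) auto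
  have lL: "l i \<le> L" if "i \<in> I" for i unfolding L_def using that by (intro Max_ge) auto
  have lip: "L-lipschitz_on F (\<psi> i)" if "i \<in> I" for i
    using lipschitz_on_le[OF l(2) lL] that by blast
  have L0: "0 \<le> L" using lipschitz_on_nonneg[OF lip[of 1]] pcf_facts(1) by auto
  have "dist (cmp w x) (cmp w y) \<le> L ^ length w * dist x y" if "set w \<subseteq> I" "x \<in> F" "y \<in> F" for w x y
    using that
  proof (induction w)
    case (Cons i w)
    have "dist (cmp (i # w) x) (cmp (i # w) y) \<le> L * dist (cmp w x) (cmp w y)"
      using Cons.prems by (auto intro!: lipschitz_onD[OF lip] cmp_in)
    also have "\<dots> \<le> L * (L ^ length w * dist x y)"
      using Cons L0 by (intro mult_left_mono) auto
    finally show ?case by (simp add: mult_ac)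
  qed simp
  with L0 L1 show ?thesis using that by blast
qed

lemma cells_shrink:
  assumes "0 < e"
  obtains N where "\<And>w x y. length w \<ge> N \<Longrightarrow> set w \<subseteq> I \<Longrightarrow> x \<in> F \<Longrightarrow> y \<in> F \<Longrightarrow> dist (cmp w x) (cmp w y) < e"
proof -
  obtain L where L: "0 \<le> L" "L < 1"
    "\<And>w x y. set w \<subseteq> I \<Longrightarrow> x \<in> F \<Longrightarrow> y \<in> F \<Longrightarrow> dist (cmp w x) (cmp w y) \<le> L ^ length w * dist x y"
    using contraction by blast
  obtain d0 where d0: "\<And>x y. x \<in> F \<Longrightarrow> y \<in> F \<Longrightarrow> dist x y \<le> d0"
    using bounded_two_points[of F] compact_imp_bounded[OF pcf_facts(3)] by blast
  define d where "d = max d0 1"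
  have d: "\<And>x y. x \<in> F \<Longrightarrow> y \<in> F \<Longrightarrow> dist x y \<le> d" "0 < d"
    using d0 unfolding d_def by force+
  obtain N where N: "L ^ N < e / d" using real_arch_pow_inv[of "e / d" L] assms d L by auto
  show ?thesis
  proof (rule that)
    fix w x y assume *: "N \<le> length w" "set w \<subseteq> I" "x \<in> F" "y \<in> F"
    have "dist (cmp w x) (cmp w y) \<le> L ^ length w * d"
      using L d * by (meson mult_left_mono order_trans zero_le_power)
    also have "\<dots> \<le> L ^ N * d" using L d * by (intro mult_right_mono power_decreasing) auto
    also have "\<dots> < e" using N d by (simp add: field_simps)
    finally show "dist (cmp w x) (cmp w y) < e" .
  qed
qed

lemma cont_cmp: assumes "set w \<subseteq> I" shows "continuous_on F (cmp w)"
proof -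
  obtain L where "0 \<le> L" "\<And>x y. x \<in> F \<Longrightarrow> y \<in> F \<Longrightarrow> dist (cmp w x) (cmp w y) \<le> L ^ length w * dist x y"
    using contraction assms by metis
  then have "(L ^ length w)-lipschitz_on F (cmp w)" by (intro lipschitz_onI) auto
  then show ?thesis by (rule lipschitz_on_continuous_on)
qed

lemma compact_cell: "set w \<subseteq> I \<Longrightarrow> compact (cmp w ` F)"
  by (intro compact_continuous_image cont_cmp pcf_facts)

lemma prefix_Suc: "prefix w (Suc n) = w 0 # prefix (shift w) n"
  unfolding shift_def by (simp add: upt_conv_Cons map_Suc_upt[symmetric] del: upt_Suc)

lemma inf_words_set: "w \<in> inf_words M \<Longrightarrow> set (prefix w n) \<subseteq> I"
  by (auto simp: inf_words_def)

lemma inf_words_shift: "w \<in> inf_words M \<Longrightarrow> shift w \<in> inf_words M"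
  by (auto simp: inf_words_def shift_def)

lemma inf_words_hd: "w \<in> inf_words M \<Longrightarrow> w n \<in> I"
  unfolding inf_words_def by blast

lemma cell_decreasing: assumes w: "w \<in> inf_words M" and "m \<le> n"
  shows "cmp (prefix w n) ` F \<subseteq> cmp (prefix w m) ` F"
proof -
  have "prefix w n = prefix w m @ map w [m..<n]"
    using \<open>m \<le> n\<close> by (metis le_add_diff_inverse map_append upt_add_eq_append zero_le)
  moreover have "set (map w [m..<n]) \<subseteq> I" using w by (auto simp: inf_words_def)
  ultimately show ?thesis using cmp_in by (auto simp only: cmp_append)
qed

lemma cell_unique:
  assumes w: "w \<in> inf_words M" and "\<And>n. x \<in> cmp (prefix w n) ` F" "\<And>n. y \<in> cmp (prefix w n) ` F"
  shows "x = y"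
proof (rule ccontr)
  assume "x \<noteq> y"
  then obtain N where N: "\<And>w x' y'. length w \<ge> N \<Longrightarrow> set w \<subseteq> I \<Longrightarrow> x' \<in> F \<Longrightarrow> y' \<in> F \<Longrightarrow> dist (cmp w x') (cmp w y') < dist x y"
    using cells_shrink[of "dist x y"] by auto
  obtain x' y' where "x' \<in> F" "y' \<in> F" "x = cmp (prefix w N) x'" "y = cmp (prefix w N) y'"
    using assms(2,3)[of N] by blast
  with N[of "prefix w N" x' y'] inf_words_set[OF w] show False by auto
qed

lemma cells_meet:
  assumes w: "w \<in> inf_words M"
  shows "\<exists>x. \<forall>n. x \<in> cmp (prefix w n) ` F"
proof -
  have "F \<inter> (\<Inter>n\<in>UNIV. cmp (prefix w n) ` F) \<noteq> {}"
  proof (rule compact_imp_fip_image)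
    show "closed (cmp (prefix w n) ` F)" for n
      by (intro compact_imp_closed compact_cell inf_words_set w)
    fix J :: "nat set" assume J: "finite J"
    define m where "m = Max (insert 0 J)"
    have "cmp (prefix w m) ` F \<subseteq> cmp (prefix w n) ` F" if "n \<in> insert 0 J" for n
      using J that by (intro cell_decreasing[OF w]) (simp add: m_def)
    then have "cmp (prefix w m) ` F \<subseteq> F \<inter> (\<Inter>n\<in>J. cmp (prefix w n) ` F)" by fastforce
    then show "F \<inter> (\<Inter>n\<in>J. cmp (prefix w n) ` F) \<noteq> {}" using pcf_facts(2) by blast
  qed (use pcf_facts in auto)
  then show ?thesis by auto
qed

lemma coding_eqI:
  assumes "w \<in> inf_words M" "\<And>n. x \<in> cmp (prefix w n) ` F"
  shows "coding F \<psi> w = x"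
proof -
  have "(\<Inter>n. cmp (prefix w n) ` F) = {x}"
    using cell_unique[OF assms(1) _ assms(2)] assms(2) by auto
  then show ?thesis unfolding coding_def by simp
qed

lemma coding_cell:
  assumes "w \<in> inf_words M"
  shows "coding F \<psi> w \<in> cmp (prefix w n) ` F"
proof -
  obtain x where x: "\<And>n. x \<in> cmp (prefix w n) ` F" using cells_meet[OF assms] by blast
  then show ?thesis using coding_eqI[OF assms x] by simp
qed

lemma coding_in: "w \<in> inf_words M \<Longrightarrow> coding F \<psi> w \<in> F"
  using coding_cell[of w 0] by simp

lemma coding_shift:
  assumes w: "w \<in> inf_words M"
  shows "coding F \<psi> w = \<psi> (w 0) (coding F \<psi> (shift w))"
proof (rule coding_eqI[OF w])
  fix n
  show "\<psi> (w 0) (coding F \<psi> (shift w)) \<in> cmp (prefix w n) ` F"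
  proof (cases n)
    case 0
    then show ?thesis using \<psi>_in[OF inf_words_hd coding_in[OF inf_words_shift]] w by auto
  next
    case (Suc k)
    show ?thesis unfolding Suc prefix_Suc
      using coding_cell[OF inf_words_shift[OF w], of k] by auto
  qed
qed

text \<open>An address of \<open>x\<close> is found by iterating a choice of preimage: each point of \<open>F\<close> lies in some first-level
cell.\<close>

lemma coding_surj:
  assumes "x \<in> F" obtains w where "w \<in> inf_words M" "coding F \<psi> w = x"
proof -
  have "\<forall>x. \<exists>iy. x \<in> F \<longrightarrow> fst iy \<in> I \<and> snd iy \<in> F \<and> x = \<psi> (fst iy) (snd iy)"
    using cell_cover by (metis fst_conv snd_conv)
  from choice[OF this] obtain step where
    step: "\<And>x. x \<in> F \<Longrightarrow> fst (step x) \<in> I \<and> snd (step x) \<in> F \<and> x = \<psi> (fst (step x)) (snd (step x))"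
    by blast
  define X where "X n = ((snd \<circ> step) ^^ n) x" for n
  define w where "w n = fst (step (X n))" for n
  have X: "X n \<in> F" for n by (induction n) (auto simp: X_def assms dest: step)
  have w: "w \<in> inf_words M" unfolding inf_words_def w_def using step[OF X] by blast
  have X_x: "cmp (prefix w n) (X n) = x" for n
  proof (induction n)
    case 0 then show ?case by (simp add: X_def)
  next
    case (Suc n)
    have "X (Suc n) = snd (step (X n))" by (simp add: X_def)
    then have "cmp (prefix w (Suc n)) (X (Suc n)) = cmp (prefix w n) (X n)"
      using step[OF X, of n] unfolding w_def by (simp add: cmp_append)
    then show ?case using Suc by simp
  qed
  have "x \<in> cmp (prefix w n) ` F" for n
    using imageI[OF X[of n], of "cmp (prefix w n)"] X_x by simp
  then have "coding F \<psi> w = x" by (rule coding_eqI[OF w])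
  with w show ?thesis using that by blast
qed

lemma post_critical_inf_words: "post_critical M F \<psi> \<subseteq> inf_words M"
proof -
  have "(shift ^^ n) w \<in> inf_words M" if "w \<in> inf_words M" for n w
    using that by (induction n) (auto intro: inf_words_shift)
  then show ?thesis unfolding post_critical_def by auto
qed

lemma post_critical_shift: assumes "w \<in> post_critical M F \<psi>" shows "shift w \<in> post_critical M F \<psi>"
proof -
  define B where "B = {w \<in> inf_words M. coding F \<psi> w \<in> (\<Union>i\<in>I. \<Union>j\<in>I - {i}. \<psi> i ` F \<inter> \<psi> j ` F)}"
  have P: "post_critical M F \<psi> = (\<Union>n\<in>{1..}. (shift ^^ n) ` B)"
    unfolding post_critical_def B_def ..
  obtain n v where n: "1 \<le> n" "w = (shift ^^ n) v" "v \<in> B" using assms unfolding P by auto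
  have "shift w = (shift ^^ (Suc n)) v" using n by simp
  then show ?thesis unfolding P using n by (intro UN_I[of "Suc n"] image_eqI) auto
qed

lemma post_critical_base:
  assumes "w \<in> inf_words M" "coding F \<psi> w \<in> \<psi> i ` F" "coding F \<psi> w \<in> \<psi> j ` F" "i \<in> I" "j \<in> I" "i \<noteq> j"
  shows "shift w \<in> post_critical M F \<psi>"
proof -
  have "coding F \<psi> w \<in> (\<Union>i\<in>I. \<Union>j\<in>I - {i}. \<psi> i ` F \<inter> \<psi> j ` F)"
    using assms by (intro UN_I[of i] UN_I[of j]) auto
  then show ?thesis
    unfolding post_critical_def using assms(1) by (intro UN_I[of 1] image_eqI[of _ _ w]) auto
qed

lemma coding_boundary: "w \<in> post_critical M F \<psi> \<Longrightarrow> coding F \<psi> w \<in> V"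
  unfolding boundary0_def by blast

lemma V_sub: "V \<subseteq> F"
  unfolding boundary0_def using post_critical_inf_words coding_in by blast

lemma finite_V: "finite V"
  unfolding boundary0_def using pcf_facts(6) by blast

text \<open>The post-critical set is invariant under the shift, so the first letter of an address of a
boundary point can be split off. Hence the vertex sets of successive levels increase.\<close>

lemma boundary_cover: assumes "p \<in> V" obtains i q where "i \<in> I" "q \<in> V" "p = \<psi> i q"
proof -
  obtain w where w: "w \<in> post_critical M F \<psi>" "p = coding F \<psi> w" using assms unfolding boundary0_def by blast
  then have "w \<in> inf_words M" using post_critical_inf_words by blast
  with w show ?thesis
    using that[OF inf_words_hd coding_boundary[OF post_critical_shift]] coding_shift by blast
qed

lemma coding_Cons:
  assumes v: "v \<in> inf_words M" and "i \<in> I"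
  shows "case_nat i v \<in> inf_words M" "shift (case_nat i v) = v"
    "coding F \<psi> (case_nat i v) = \<psi> i (coding F \<psi> v)"
proof -
  show s: "shift (case_nat i v) = v" by (simp add: shift_def)
  show w: "case_nat i v \<in> inf_words M"
    using assms unfolding inf_words_def by (auto split: nat.split)
  show "coding F \<psi> (case_nat i v) = \<psi> i (coding F \<psi> v)" using coding_shift[OF w] s by simp
qed

text \<open>This is the purpose of the post-critical set: prefixing an address of \<open>x\<close> with \<open>i\<close> gives an address
of a point that two cells share, and the shift of such an address is post-critical by
definition.\<close>

lemma cells_inter:
  assumes "i \<in> I" "j \<in> I" "i \<noteq> j" "x \<in> F" "y \<in> F" "\<psi> i x = \<psi> j y"
  shows "x \<in> V"
proof -
  obtain v where v: "v \<in> inf_words M" "coding F \<psi> v = x" using coding_surj assms(4) by blast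
  define w where "w = case_nat i v"
  have s: "shift w = v" and w: "w \<in> inf_words M" and "coding F \<psi> w = \<psi> i x"
    using coding_Cons[OF v(1) assms(1)] v(2) by (simp_all add: w_def)
  then have "shift w \<in> post_critical M F \<psi>"
    using assms(1-3) imageI[OF assms(4), of "\<psi> i"] imageI[OF assms(5), of "\<psi> j"] assms(6)
    by (intro post_critical_base[of w i j] w) simp_all
  then show ?thesis using coding_boundary v s by metis
qed

text \<open>Connectedness of \<open>F\<close> as a statement about vertices: a set of first-level cells that is closed under
sharing vertices splits \<open>F\<close> into two disjoint closed sets, because cells meet only at
vertices.\<close>

lemma connected_by_boundary:
  assumes "J \<subseteq> I" "J \<noteq> {}"
    and step: "\<And>i j p q. i \<in> J \<Longrightarrow> j \<in> I \<Longrightarrow> p \<in> V \<Longrightarrow> q \<in> V \<Longrightarrow> \<psi> i p = \<psi> j q \<Longrightarrow> j \<in> J"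
  shows "J = I"
proof (rule ccontr)
  assume "J \<noteq> I"
  define A B where "A = (\<Union>i\<in>J. \<psi> i ` F)" and "B = (\<Union>i\<in>I-J. \<psi> i ` F)"
  have cl: "closed (\<psi> i ` F)" if "i \<in> I" for i
    using compact_imp_closed[OF compact_cell[of "[i]"]] that by simp
  have fin: "finite J" using assms(1) finite_subset by blast
  have "closed A" unfolding A_def by (rule closed_UN[OF fin]) (use cl assms(1) in blast)
  moreover have "closed B" unfolding B_def by (rule closed_UN) (use cl in auto)
  moreover have "F = A \<union> B"
  proof -
    have "A \<union> B = (\<Union>i\<in>I. \<psi> i ` F)" unfolding A_def B_def using assms(1) by blast
    also have "\<dots> = F" by (rule pcf_facts(5)[symmetric])
    finally show ?thesis ..
  qed
  moreover have "A \<inter> B = {}"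
  proof (rule ccontr)
    assume "A \<inter> B \<noteq> {}"
    then obtain i j x y where *: "i \<in> J" "j \<in> I - J" "x \<in> F" "y \<in> F" "\<psi> i x = \<psi> j y"
      unfolding A_def B_def by blast
    then have "i \<noteq> j" "i \<in> I" "j \<in> I" using assms(1) by auto
    then have "x \<in> V" "y \<in> V" using cells_inter[of i j x y] cells_inter[of j i y x] * by auto
    then show False using step[of i j x y] * by auto
  qed
  moreover have "A \<noteq> {}" "B \<noteq> {}" unfolding A_def B_def using assms(1,2) \<open>J \<noteq> I\<close> pcf_facts(2) by auto
  ultimately show False using pcf_facts(4) unfolding connected_closed by blast
qed

text \<open>Without boundary points distinct cells would be disjoint, and a single cell would be closed under
sharing vertices.\<close>

lemma V_nonempty: "V \<noteq> {}"
proof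
  assume "V = {}"
  then have "{1} = I" using pcf_facts(1) by (intro connected_by_boundary) auto
  then have "2 \<in> {1::nat} \<longleftrightarrow> 2 \<in> I" by (rule arg_cong)
  then show False using pcf_facts(1) by simp
qed

lemma words_0: "words M 0 = {[]}"
  unfolding words_def by auto

lemma words_Suc: "words M (Suc n) = (\<lambda>(i, w). i # w) ` (I \<times> words M n)"
proof
  show "words M (Suc n) \<subseteq> (\<lambda>(i, w). i # w) ` (I \<times> words M n)"
  proof
    fix v assume "v \<in> words M (Suc n)"
    then obtain i w where "v = i # w" "i \<in> I" "w \<in> words M n"
      unfolding words_def by (cases v) auto
    then show "v \<in> (\<lambda>(i, w). i # w) ` (I \<times> words M n)" by force
  qed
qed (auto simp: words_def)

lemma finite_words: "finite (words M n)"
  by (induction n) (simp_all add: words_0 words_Suc)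

lemma Cons_words: "i \<in> I \<Longrightarrow> w \<in> words M n \<Longrightarrow> i # w \<in> words M (Suc n)"
  by (auto simp: words_def)

lemma F_words: "x \<in> F \<Longrightarrow> \<exists>w\<in>words M n. x \<in> cmp w ` F"
proof (induction n arbitrary: x)
  case 0
  then show ?case by (intro bexI[of _ "[]"]) (auto simp: words_def)
next
  case (Suc n)
  obtain i y where iy: "i \<in> I" "y \<in> F" "x = \<psi> i y" using cell_cover[OF Suc.prems] .
  obtain w where w: "w \<in> words M n" "y \<in> cmp w ` F" using Suc.IH[OF iy(2)] by blast
  then show ?case using iy Cons_words[OF iy(1) w(1)] by (intro bexI[of _ "i # w"]) auto
qed

lemma V_words: "x \<in> V \<Longrightarrow> \<exists>w\<in>words M n. x \<in> cmp w ` V"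
proof (induction n arbitrary: x)
  case 0
  then show ?case by (intro bexI[of _ "[]"]) (auto simp: words_def)
next
  case (Suc n)
  obtain i y where iy: "i \<in> I" "y \<in> V" "x = \<psi> i y" using boundary_cover[OF Suc.prems] .
  obtain w where w: "w \<in> words M n" "y \<in> cmp w ` V" using Suc.IH[OF iy(2)] by blast
  then show ?case using iy Cons_words[OF iy(1) w(1)] by (intro bexI[of _ "i # w"]) auto
qed

lemma words_set: "w \<in> words M n \<Longrightarrow> set w \<subseteq> I" and words_length: "w \<in> words M n \<Longrightarrow> length w = n"
  by (auto simp: words_def)

text \<open>Near \<open>x\<close> only those of the finitely many cells of a level appear that contain \<open>x\<close>, since the union of
the others is closed.\<close>

lemma continuous_if_small_osc_on_cells:
  fixes f :: "'a \<Rightarrow> real"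
  assumes osc: "\<And>e. 0 < e \<Longrightarrow> \<exists>n. \<forall>w\<in>words M n. \<forall>x\<in>F. \<forall>y\<in>F. \<bar>f (cmp w x) - f (cmp w y)\<bar> < e"
  shows "continuous_on F f"
  unfolding continuous_on_iff
proof (intro ballI allI impI)
  fix x e assume x: "x \<in> F" and "0 < (e::real)"
  then obtain n where n: "\<And>w x y. w \<in> words M n \<Longrightarrow> x \<in> F \<Longrightarrow> y \<in> F \<Longrightarrow> \<bar>f (cmp w x) - f (cmp w y)\<bar> < e"
    using osc by blast
  define W where "W = {w \<in> words M n. x \<notin> cmp w ` F}"
  define C where "C = (\<Union>w\<in>W. cmp w ` F)"
  have "closed C" unfolding C_def
  proof (rule closed_UN)
    show "finite W" unfolding W_def using finite_words by simp
    show "\<forall>w\<in>W. closed (cmp w ` F)"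
    proof
      fix w assume "w \<in> W"
      then have "w \<in> words M n" unfolding W_def by simp
      then show "closed (cmp w ` F)" by (intro compact_imp_closed compact_cell words_set)
    qed
  qed
  then have "open (- C)" by (rule open_Compl)
  moreover have "x \<in> - C" unfolding C_def W_def by simp
  ultimately have "\<exists>d>0. \<forall>y. dist y x < d \<longrightarrow> y \<in> - C" unfolding open_dist by simp
  then obtain d where d: "0 < d" "\<And>y. dist y x < d \<Longrightarrow> y \<in> - C" by auto
  have "dist (f y) (f x) < e" if y: "y \<in> F" "dist y x < d" for y
  proof -
    obtain w where w: "w \<in> words M n" "y \<in> cmp w ` F" using F_words[OF y(1)] by blast
    then have "w \<notin> W" using d(2)[OF y(2)] unfolding C_def by blast
    then have "x \<in> cmp w ` F" using w(1) unfolding W_def by simp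
    with w(2) obtain x' y' where "x' \<in> F" "y' \<in> F" "x = cmp w x'" "y = cmp w y'" by auto
    then show ?thesis using n[OF w(1), of y' x'] by (simp add: dist_real_def)
  qed
  then show "\<exists>d>0. \<forall>x'\<in>F. dist x' x < d \<longrightarrow> dist (f x') (f x) < e" using d(1) by blast
qed

end

section \<open>Energy controls oscillation\<close>

text \<open>Keeping the constant existential turns control of increments by a quadratic form into an
equivalence relation on points, to which connectedness arguments apply.\<close>

definition controlled :: "(('a \<Rightarrow> real) \<Rightarrow> real) \<Rightarrow> 'a \<Rightarrow> 'a \<Rightarrow> bool" where
  "controlled Q x y \<longleftrightarrow> (\<exists>K. \<forall>f. (f x - f y)\<^sup>2 \<le> K * Q f)"

lemma controlled_refl: "controlled Q x x"
  unfolding controlled_def by (intro exI[of _ 0]) auto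

lemma controlled_sym: "controlled Q x y \<Longrightarrow> controlled Q y x"
  unfolding controlled_def by (simp add: power2_commute)

lemma controlled_trans:
  assumes "controlled Q x y" "controlled Q y z"
  shows "controlled Q x z"
proof -
  obtain K L where KL: "\<And>f. (f x - f y)\<^sup>2 \<le> K * Q f" "\<And>f. (f y - f z)\<^sup>2 \<le> L * Q f"
    using assms unfolding controlled_def by blast
  have "(f x - f z)\<^sup>2 \<le> (2 * K + 2 * L) * Q f" for f
  proof -
    have "(f x - f z)\<^sup>2 \<le> 2 * (f x - f y)\<^sup>2 + 2 * (f y - f z)\<^sup>2"
      using zero_le_power2[of "(f x - f y) - (f y - f z)"] by (simp add: power2_eq_square algebra_simps)
    then show ?thesis using KL[of f] by (simp add: algebra_simps)
  qed
  then show ?thesis unfolding controlled_def by blast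
qed

lemma controlled_uniform:
  assumes "finite T" and "\<And>f. 0 \<le> Q f" and "\<And>x y. x \<in> T \<Longrightarrow> y \<in> T \<Longrightarrow> controlled Q x y"
  obtains K where "0 \<le> K" "\<And>f x y. x \<in> T \<Longrightarrow> y \<in> T \<Longrightarrow> (f x - f y)\<^sup>2 \<le> K * Q f"
proof -
  have "\<forall>e. \<exists>K. e \<in> T \<times> T \<longrightarrow> (\<forall>f. (f (fst e) - f (snd e))\<^sup>2 \<le> K * Q f)"
    using assms(3) unfolding controlled_def by auto
  from choice[OF this] obtain K where
    K: "\<And>e f. e \<in> T \<times> T \<Longrightarrow> (f (fst e) - f (snd e))\<^sup>2 \<le> K e * Q f" by blast
  define L where "L = (\<Sum>e\<in>T \<times> T. \<bar>K e\<bar>)"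
  show ?thesis
  proof (rule that[of L])
    show "0 \<le> L" unfolding L_def by (rule sum_nonneg) auto
    fix f x y assume xy: "x \<in> T" "y \<in> T"
    have "K (x, y) \<le> L"
      using member_le_sum[of "(x, y)" "T \<times> T" "\<lambda>e. \<bar>K e\<bar>"] xy assms(1) unfolding L_def by simp
    then have "K (x, y) * Q f \<le> L * Q f" using assms(2) by (intro mult_right_mono) auto
    then show "(f x - f y)\<^sup>2 \<le> L * Q f" using K[of "(x, y)" f] xy by simp
  qed
qed

locale harmonic_structure = pcf_set M F \<psi>
  for M :: nat and F :: "'a::metric_space set" and \<psi> :: "nat \<Rightarrow> 'a \<Rightarrow> 'a" +
  fixes A :: "'a \<Rightarrow> 'a \<Rightarrow> real" and r :: "nat \<Rightarrow> real"
  assumes harm: "regular_harmonic_structure M F \<psi> A r"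
begin

abbreviation E0 :: "('a \<Rightarrow> real) \<Rightarrow> real" where "E0 f \<equiv> energy0 V A f f"
abbreviation E :: "nat \<Rightarrow> ('a \<Rightarrow> real) \<Rightarrow> real" where "E n f \<equiv> energy M F \<psi> A r n f f"
abbreviation r_word :: "nat list \<Rightarrow> real" where "r_word w \<equiv> prod_list (map r w)"

lemma r_pos: "i \<in> I \<Longrightarrow> 0 < r i" and r_less_1: "i \<in> I \<Longrightarrow> r i < 1"
  and A_sym: "x \<in> V \<Longrightarrow> y \<in> V \<Longrightarrow> A x y = A y x"
  and E0_nonneg: "0 \<le> E0 f"
  and A_nonneg: "x \<in> V \<Longrightarrow> y \<in> V \<Longrightarrow> x \<noteq> y \<Longrightarrow> 0 \<le> A x y"
  and A_kernel: "(\<forall>x\<in>V. (\<Sum>y\<in>V. A x y * f y) = 0) \<longleftrightarrow> (\<exists>c. \<forall>x\<in>V. f x = c)"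
  and E1_attained: "\<exists>g. (\<forall>x\<in>V. g x = f x) \<and> E 1 g = E0 f"
  and E0_le_E1: "E0 f \<le> E 1 f"
  using harm unfolding regular_harmonic_structure_def Let_def energy0_def by auto

lemma E0_cong: "(\<And>p. p \<in> V \<Longrightarrow> f p = g p) \<Longrightarrow> E0 f = E0 g"
  unfolding energy0_def by (auto intro!: sum.cong)

text \<open>The rows of the matrix sum to zero since constants lie in its kernel; completing the square then
turns the form into a sum over edges with non-negative weights.\<close>

lemma E0_eq: "E0 f = (\<Sum>x\<in>V. \<Sum>y\<in>V. A x y * (f x - f y)\<^sup>2) / 2"
proof -
  have row: "(\<Sum>y\<in>V. A x y) = 0" if "x \<in> V" for x
    using A_kernel[of "\<lambda>_. 1"] that by auto
  have "(\<Sum>x\<in>V. \<Sum>y\<in>V. A x y * (f x)\<^sup>2) = (\<Sum>x\<in>V. (f x)\<^sup>2 * (\<Sum>y\<in>V. A x y))"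
    by (simp add: sum_distrib_left mult_ac)
  also have "\<dots> = 0" using row by simp
  finally have 1: "(\<Sum>x\<in>V. \<Sum>y\<in>V. A x y * (f x)\<^sup>2) = 0" .
  have "(\<Sum>x\<in>V. \<Sum>y\<in>V. A x y * (f y)\<^sup>2) = (\<Sum>y\<in>V. \<Sum>x\<in>V. A y x * (f y)\<^sup>2)"
    by (subst sum.swap) (auto intro!: sum.cong simp: A_sym)
  then have 2: "(\<Sum>x\<in>V. \<Sum>y\<in>V. A x y * (f y)\<^sup>2) = 0" using 1 by simp
  have "(\<Sum>x\<in>V. \<Sum>y\<in>V. A x y * (f x - f y)\<^sup>2)
     = (\<Sum>x\<in>V. \<Sum>y\<in>V. A x y * (f x)\<^sup>2) + (\<Sum>x\<in>V. \<Sum>y\<in>V. A x y * (f y)\<^sup>2)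
       - 2 * (\<Sum>x\<in>V. \<Sum>y\<in>V. f x * A x y * f y)"
    by (simp add: sum.distrib[symmetric] sum_subtractf[symmetric] sum_distrib_left power2_eq_square algebra_simps)
  then show ?thesis using 1 2 by (simp add: energy0_def)
qed

lemma E0_edge:
  assumes "x \<in> V" "y \<in> V" "0 < A x y" "x \<noteq> y"
  shows "controlled (\<lambda>f. E0 f) x y"
proof -
  have "(f x - f y)\<^sup>2 \<le> (2 / A x y) * E0 f" for f
  proof -
    have nn: "0 \<le> A x y * (f x - f y)\<^sup>2" if "x \<in> V" "y \<in> V" for x y
      using A_nonneg[OF that] by (cases "x = y") auto
    have "A x y * (f x - f y)\<^sup>2 \<le> (\<Sum>y\<in>V. A x y * (f x - f y)\<^sup>2)"
      using assms nn finite_V by (intro member_le_sum) auto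
    also have "\<dots> \<le> (\<Sum>x\<in>V. \<Sum>y\<in>V. A x y * (f x - f y)\<^sup>2)"
      using assms nn finite_V by (intro member_le_sum[where f="\<lambda>x. \<Sum>y\<in>V. A x y * (f x - f y)\<^sup>2"] sum_nonneg) auto
    also have "\<dots> = 2 * E0 f" by (simp add: E0_eq)
    finally show ?thesis using assms by (simp add: field_simps)
  qed
  then show ?thesis unfolding controlled_def by blast
qed

text \<open>The indicator of the points controlled from \<open>x\<close> lies in the kernel of the matrix, because no edge
leaves that set. The kernel consists of the constants, so the set is all of \<open>V\<close>.\<close>

lemma E0_controls:
  assumes "x \<in> V" "y \<in> V"
  shows "controlled (\<lambda>f. E0 f) x y"
proof -
  \<comment> \<open>An edge between \<open>?C\<close> and its complement would extend the control.\<close>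
  let ?C = "{y \<in> V. controlled (\<lambda>f. E0 f) x y}"
  let ?f = "indicat_real ?C"
  have row: "(\<Sum>y\<in>V. A u y) = 0" if "u \<in> V" for u
    using A_kernel[of "\<lambda>_. 1"] that by auto
  have cut: "A u v = 0" if "u \<in> V" "v \<in> V" "u \<in> ?C \<longleftrightarrow> v \<notin> ?C" for u v
  proof (rule ccontr)
    assume "A u v \<noteq> 0"
    moreover have "u \<noteq> v" using that(3) by auto
    ultimately have "controlled (\<lambda>f. E0 f) u v"
      using E0_edge[of u v] A_nonneg[of u v] that by auto
    then show False
      using that controlled_trans[of "\<lambda>f. E0 f" x u v] controlled_trans[of "\<lambda>f. E0 f" x v u]
        controlled_sym[of "\<lambda>f. E0 f" u v] by auto
  qed
  have "(\<Sum>v\<in>V. A u v * ?f v) = 0" if u: "u \<in> V" for u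
  proof (cases "u \<in> ?C")
    case True
    have "(\<Sum>v\<in>V. A u v * ?f v) = (\<Sum>v\<in>V. A u v)"
      using cut[OF u] True by (intro sum.cong refl) (auto simp: indicator_def)
    then show ?thesis using row[OF u] by simp
  next
    case False
    then show ?thesis
      using cut[OF u] by (intro sum.neutral) (auto simp: indicator_def)
  qed
  then obtain c where c: "\<forall>u\<in>V. ?f u = c" using A_kernel[of ?f] by blast
  moreover have "?f x = 1" using assms controlled_refl by (simp add: indicator_def)
  ultimately have "?f y = 1" using assms by metis
  then show ?thesis by (simp add: indicator_def split: if_splits)
qed

lemma E_0: "E 0 f = E0 f"
  unfolding energy_def words_0 by (simp add: comp_def)

text \<open>Self-similarity of the energies, the basis for all inductions on the level.\<close>

lemma E_Suc: "E (Suc n) f = (\<Sum>i\<in>I. inverse (r i) * E n (f \<circ> \<psi> i))"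
proof -
  have inj: "inj_on (\<lambda>(i, w). i # w) (I \<times> words M n)" by (auto simp: inj_on_def)
  have "E (Suc n) f = (\<Sum>(i, w)\<in>I \<times> words M n. inverse (r_word (i # w)) * E0 (f \<circ> cmp (i # w)))"
    unfolding energy_def words_Suc sum.reindex[OF inj] by (simp add: case_prod_unfold)
  also have "\<dots> = (\<Sum>i\<in>I. \<Sum>w\<in>words M n. inverse (r_word (i # w)) * E0 (f \<circ> cmp (i # w)))"
    by (simp add: sum.cartesian_product)
  finally show ?thesis
    unfolding energy_def by (simp add: sum_distrib_left o_assoc mult_ac)
qed

lemma E_1: "E 1 f = (\<Sum>i\<in>I. inverse (r i) * E0 (f \<circ> \<psi> i))"
  using E_Suc[of 0 f] by (simp add: E_0)

lemma E_nonneg: "0 \<le> E n f"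
proof (induction n arbitrary: f)
  case 0 then show ?case by (simp add: E_0 E0_nonneg)
next
  case (Suc n)
  then show ?case unfolding E_Suc using r_pos by (intro sum_nonneg mult_nonneg_nonneg) (auto simp: less_imp_le)
qed

lemma E_Suc_mono: "E n f \<le> E (Suc n) f"
proof (induction n arbitrary: f)
  case 0 then show ?case using E0_le_E1[of f] by (simp add: E_0)
next
  case (Suc n)
  have "(\<Sum>i\<in>I. inverse (r i) * E n (f \<circ> \<psi> i)) \<le> (\<Sum>i\<in>I. inverse (r i) * E (Suc n) (f \<circ> \<psi> i))"
    using r_pos by (intro sum_mono mult_left_mono Suc) (simp add: less_imp_le)
  then show ?case by (simp only: E_Suc[of n f] E_Suc[of "Suc n" f])
qed

lemma E_mono: "m \<le> n \<Longrightarrow> E m f \<le> E n f"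
  by (rule lift_Suc_mono_le[of "\<lambda>n. E n f"]) (rule E_Suc_mono)

lemma E_cong:
  assumes "\<And>x. x \<in> F \<Longrightarrow> f x = g x"
  shows "E n f = E n g"
  unfolding energy_def using assms V_sub
  by (intro sum.cong refl arg_cong[where f="\<lambda>t. _ * t"] E0_cong) (auto simp: words_def intro!: assms cmp_in)

lemma r_word_pos: "set w \<subseteq> I \<Longrightarrow> 0 < r_word w"
  by (induction w) (auto intro!: mult_pos_pos r_pos)

lemma E_child: assumes "i \<in> I" shows "E n (f \<circ> \<psi> i) \<le> r i * E (Suc n) f"
proof -
  have "inverse (r i) * E n (f \<circ> \<psi> i) \<le> E (Suc n) f"
    unfolding E_Suc using assms r_pos E_nonneg
    by (intro member_le_sum[where f="\<lambda>i. inverse (r i) * E n (f \<circ> \<psi> i)"] mult_nonneg_nonneg) (auto simp: less_imp_le)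
  then show ?thesis using r_pos[OF assms] by (simp add: field_simps)
qed

text \<open>Dropping all terms of the energy that belong to other cells.\<close>

lemma E_cell: "set w \<subseteq> I \<Longrightarrow> E n (f \<circ> cmp w) \<le> r_word w * E (length w + n) f"
proof (induction w arbitrary: f)
  case (Cons i w)
  have "E n (f \<circ> cmp (i # w)) = E n ((f \<circ> \<psi> i) \<circ> cmp w)" by (simp add: o_assoc)
  also have "\<dots> \<le> r_word w * E (length w + n) (f \<circ> \<psi> i)" using Cons.prems by (intro Cons.IH) simp
  also have "\<dots> \<le> r_word w * (r i * E (Suc (length w + n)) f)"
    using Cons.prems r_word_pos[of w] by (intro mult_left_mono E_child) auto
  finally show ?case by (simp add: o_def mult_ac)
qed simp

text \<open>Within a cell this is the control by \<open>E0\<close>, rescaled; it propagates to all cells because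
neighbouring cells share a vertex.\<close>

lemma E1_controls:
  assumes "x \<in> (\<Union>i\<in>I. \<psi> i ` V)" "y \<in> (\<Union>i\<in>I. \<psi> i ` V)"
  shows "controlled (\<lambda>f. E 1 f) x y"
proof -
  have cell: "controlled (\<lambda>f. E 1 f) (\<psi> i p) (\<psi> i q)" if i: "i \<in> I" and pq: "p \<in> V" "q \<in> V" for i p q
  proof -
    obtain K where K: "\<And>f. (f p - f q)\<^sup>2 \<le> K * E0 f"
      using E0_controls[OF pq] unfolding controlled_def by blast
    have "(f (\<psi> i p) - f (\<psi> i q))\<^sup>2 \<le> (\<bar>K\<bar> * r i) * E 1 f" for f
    proof -
      have "(f (\<psi> i p) - f (\<psi> i q))\<^sup>2 \<le> K * E0 (f \<circ> \<psi> i)" using K[of "f \<circ> \<psi> i"] by simp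
      also have "\<dots> \<le> \<bar>K\<bar> * E0 (f \<circ> \<psi> i)" by (intro mult_right_mono E0_nonneg) auto
      also have "\<dots> \<le> \<bar>K\<bar> * (r i * E 1 f)"
        using E_child[OF i, of 0 f] by (intro mult_left_mono) (auto simp: E_0)
      finally show ?thesis by simp
    qed
    then show ?thesis unfolding controlled_def by blast
  qed
  obtain i p j q where x: "i \<in> I" "p \<in> V" "x = \<psi> i p" and y: "j \<in> I" "q \<in> V" "y = \<psi> j q"
    using assms by auto
  define J where "J = {j \<in> I. \<exists>q\<in>V. controlled (\<lambda>f. E 1 f) x (\<psi> j q)}"
  have "J = I"
  proof (rule connected_by_boundary)
    show "J \<subseteq> I" unfolding J_def by blast
    have "controlled (\<lambda>f. E 1 f) x (\<psi> i p)" unfolding x(3) by (rule controlled_refl)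
    then have "i \<in> J" unfolding J_def using x by auto
    then show "J \<noteq> {}" by auto
    fix i j p q assume *: "i \<in> J" "j \<in> I" "p \<in> V" "q \<in> V" "\<psi> i p = \<psi> j q"
    then obtain p' where "p' \<in> V" "controlled (\<lambda>f. E 1 f) x (\<psi> i p')" "i \<in> I" unfolding J_def by auto
    then have "controlled (\<lambda>f. E 1 f) x (\<psi> j q)"
      using controlled_trans[OF _ cell[of i p' p]] * by simp
    then show "j \<in> J" unfolding J_def using * by auto
  qed
  with y(1) have "j \<in> J" by simp
  then obtain q' where "q' \<in> V" "controlled (\<lambda>f. E 1 f) x (\<psi> j q')" unfolding J_def by auto
  then show ?thesis using controlled_trans[OF _ cell[of j q' q]] y by simp
qed

definition level1_const :: real where
  "level1_const = (SOME K. 0 \<le> K \<and> (\<forall>f. \<forall>x\<in>\<Union>i\<in>I. \<psi> i ` V. \<forall>y\<in>\<Union>i\<in>I. \<psi> i ` V. (f x - f y)\<^sup>2 \<le> K * E 1 f))"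

lemma level1_const: "0 \<le> level1_const"
    "x \<in> (\<Union>i\<in>I. \<psi> i ` V) \<Longrightarrow> y \<in> (\<Union>i\<in>I. \<psi> i ` V) \<Longrightarrow> (f x - f y)\<^sup>2 \<le> level1_const * E 1 f"
proof -
  have fin: "finite (\<Union>i\<in>I. \<psi> i ` V)" using finite_V by blast
  obtain K where K: "0 \<le> K" "\<And>f x y. x \<in> (\<Union>i\<in>I. \<psi> i ` V) \<Longrightarrow> y \<in> (\<Union>i\<in>I. \<psi> i ` V) \<Longrightarrow> (f x - f y)\<^sup>2 \<le> K * E 1 f"
    using controlled_uniform[where T="\<Union>i\<in>I. \<psi> i ` V" and Q="\<lambda>f. E 1 f", OF fin E_nonneg E1_controls]
    by blast
  have "\<exists>K. 0 \<le> K \<and> (\<forall>f. \<forall>x\<in>\<Union>i\<in>I. \<psi> i ` V. \<forall>y\<in>\<Union>i\<in>I. \<psi> i ` V. (f x - f y)\<^sup>2 \<le> K * E 1 f)"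
    using K by blast
  from someI_ex[OF this] have "0 \<le> level1_const \<and> (\<forall>f. \<forall>x\<in>\<Union>i\<in>I. \<psi> i ` V. \<forall>y\<in>\<Union>i\<in>I. \<psi> i ` V. (f x - f y)\<^sup>2 \<le> level1_const * E 1 f)"
    unfolding level1_const_def .
  then show "0 \<le> level1_const" "x \<in> (\<Union>i\<in>I. \<psi> i ` V) \<Longrightarrow> y \<in> (\<Union>i\<in>I. \<psi> i ` V) \<Longrightarrow> (f x - f y)\<^sup>2 \<le> level1_const * E 1 f"
    by blast+
qed

definition rmax :: real where "rmax = Max (r ` I)"

lemma rmax: "0 < rmax" "rmax < 1" "i \<in> I \<Longrightarrow> r i \<le> rmax"
proof -
  have ne: "r ` I \<noteq> {}" "1 \<in> I" using pcf_facts(1) by auto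
  show "i \<in> I \<Longrightarrow> r i \<le> rmax" for i unfolding rmax_def by (intro Max_ge) auto
  from this[OF ne(2)] r_pos[OF ne(2)] show "0 < rmax" by linarith
  show "rmax < 1" unfolding rmax_def using ne r_less_1 by (subst Max_less_iff) auto
qed

lemma r_word_le_power: "set w \<subseteq> I \<Longrightarrow> r_word w \<le> rmax ^ length w"
proof (induction w)
  case (Cons i w)
  then show ?case using rmax r_pos r_word_pos[of w] by (auto intro!: mult_mono simp: less_imp_le)
qed simp

definition osc_const :: real where "osc_const = sqrt level1_const / (1 - sqrt rmax)"

lemma osc_const_nonneg: "0 \<le> osc_const"
  unfolding osc_const_def using level1_const(1) rmax by simp

text \<open>Both the functions of the domain and the iterated minimal extensions are followed along an
infinite word in the same way. The functions \<open>g n\<close> describe what is seen on the cell of the first \<open>n\<close> letters,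
pulled back to level one; consecutive values at \<open>p\<close> are values of the same \<open>g n\<close> at two
first-level vertices, hence close by \<open>level1_const\<close>, and the resulting series is geometric with ratio
\<open>sqrt rmax\<close>.\<close>

lemma chain_along_word:
  assumes w: "\<And>n. w n \<in> I" and p: "p \<in> V" and B: "0 \<le> B"
    and energy: "\<And>n. E 1 (g n) \<le> rmax ^ n * B"
    and link: "\<And>n. g n (\<psi> (w n) p) = g (Suc n) p"
  shows "convergent (\<lambda>n. g n p)" "\<bar>g 0 p - lim (\<lambda>n. g n p)\<bar> \<le> osc_const * sqrt B"
proof -
  have V1: "p \<in> (\<Union>i\<in>I. \<psi> i ` V)" by (rule boundary_cover[OF p]) auto
  have step: "dist (g n p) (g (Suc n) p) \<le> sqrt (level1_const * B) * sqrt rmax ^ n" for n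
  proof -
    have "(g n p - g (Suc n) p)\<^sup>2 \<le> level1_const * E 1 (g n)"
    proof -
      have "\<psi> (w n) p \<in> (\<Union>i\<in>I. \<psi> i ` V)" by (rule UN_I[OF w[of n]]) (use p in simp)
      from level1_const(2)[OF V1 this, of "g n"] show ?thesis by (simp only: link)
    qed
    also have "\<dots> \<le> level1_const * (rmax ^ n * B)" by (intro mult_left_mono energy level1_const)
    finally have "\<bar>g n p - g (Suc n) p\<bar> \<le> sqrt (level1_const * (rmax ^ n * B))"
      by (auto dest: real_sqrt_le_mono)
    then show ?thesis by (simp add: dist_real_def real_sqrt_mult real_sqrt_power mult_ac)
  qed
  have s: "0 \<le> sqrt rmax" "sqrt rmax < 1" using rmax by auto
  note conv = geometric_steps_convergent[OF step s]
  show "convergent (\<lambda>n. g n p)" by (rule conv)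
  show "\<bar>g 0 p - lim (\<lambda>n. g n p)\<bar> \<le> osc_const * sqrt B"
    using conv(2)[of 0] by (simp add: dist_real_def osc_const_def real_sqrt_mult)
qed

lemma tendsto_coding:
  assumes "w \<in> inf_words M" "p \<in> F"
  shows "(\<lambda>n. cmp (prefix w n) p) \<longlonglongrightarrow> coding F \<psi> w"
proof (rule metric_LIMSEQ_I)
  fix e :: real assume "0 < e"
  then obtain N where N: "\<And>w x y. length w \<ge> N \<Longrightarrow> set w \<subseteq> I \<Longrightarrow> x \<in> F \<Longrightarrow> y \<in> F \<Longrightarrow> dist (cmp w x) (cmp w y) < e"
    using cells_shrink by blast
  have "dist (cmp (prefix w n) p) (coding F \<psi> w) < e" if "n \<ge> N" for n
  proof -
    obtain y where "y \<in> F" "coding F \<psi> w = cmp (prefix w n) y"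
      using coding_cell[OF assms(1), of n] by blast
    then show ?thesis using N[of "prefix w n" p y] that assms inf_words_set by simp
  qed
  then show "\<exists>N. \<forall>n\<ge>N. dist (cmp (prefix w n) p) (coding F \<psi> w) < e" by blast
qed

text \<open>The images of \<open>p\<close> in the cells along an address of \<open>x\<close> converge to \<open>x\<close>, and \<open>chain_along_word\<close>
applies to the pullbacks of \<open>f\<close> to these cells.\<close>

lemma boundary_osc:
  assumes cont: "continuous_on F f" and B: "\<And>n. E n f \<le> B" and x: "x \<in> F" and p: "p \<in> V"
  shows "\<bar>f p - f x\<bar> \<le> osc_const * sqrt B"
proof -
  obtain w where w: "w \<in> inf_words M" "coding F \<psi> w = x" using coding_surj[OF x] .
  define g where "g n = f \<circ> cmp (prefix w n)" for n
  have B0: "0 \<le> B" using E_nonneg[of 0 f] B[of 0] by linarith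
  have energy: "E 1 (g n) \<le> rmax ^ n * B" for n
  proof -
    have "E 1 (g n) \<le> r_word (prefix w n) * E (n + 1) f"
      unfolding g_def using E_cell[OF inf_words_set[OF w(1)], of 1 f n] by simp
    also have "\<dots> \<le> rmax ^ n * B"
      using r_word_le_power[OF inf_words_set[OF w(1)], of n] B[of "n + 1"] rmax E_nonneg
      by (intro mult_mono) auto
    finally show ?thesis .
  qed
  have link: "g n (\<psi> (w n) p) = g (Suc n) p" for n by (simp add: g_def cmp_append)
  have "(\<lambda>n. g n p) \<longlonglongrightarrow> f x"
    unfolding g_def o_def
  proof (rule continuous_on_tendsto_compose[OF cont])
    show "(\<lambda>n. cmp (prefix w n) p) \<longlonglongrightarrow> x" using tendsto_coding[OF w(1)] w(2) V_sub p by blast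
    show "\<forall>\<^sub>F n in sequentially. cmp (prefix w n) p \<in> F"
      using cmp_in[OF inf_words_set[OF w(1)]] V_sub p by (intro always_eventually) blast
  qed (rule x)
  then show ?thesis
    using chain_along_word(2)[OF inf_words_hd[OF w(1)] p B0 energy link]
    by (simp add: limI g_def)
qed

lemma energy_osc:
  assumes "continuous_on F f" "\<And>n. E n f \<le> B" "x \<in> F" "y \<in> F"
  shows "(f x - f y)\<^sup>2 \<le> (2 * osc_const)\<^sup>2 * B"
proof -
  obtain p where p: "p \<in> V" using V_nonempty by blast
  have B0: "0 \<le> B" using E_nonneg[of 0 f] assms(2)[of 0] by linarith
  have "\<bar>f x - f y\<bar> \<le> 2 * osc_const * sqrt B"
    using boundary_osc[OF assms(1,2) assms(3) p] boundary_osc[OF assms(1,2) assms(4) p] by linarith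
  then have "\<bar>f x - f y\<bar>\<^sup>2 \<le> (2 * osc_const * sqrt B)\<^sup>2" by (intro power_mono) auto
  then show ?thesis using B0 by (simp add: power_mult_distrib)
qed

section \<open>Harmonic and piecewise harmonic functions\<close>

abbreviation "D \<equiv> dirichlet_domain M F \<psi> A r"

definition energy_ext :: "('a \<Rightarrow> real) \<Rightarrow> 'a \<Rightarrow> real" where
  "energy_ext f = (SOME g. (\<forall>x\<in>V. g x = f x) \<and> E 1 g = E0 f)"

lemma energy_ext: "p \<in> V \<Longrightarrow> energy_ext f p = f p" "E 1 (energy_ext f) = E0 f"
proof -
  have "(\<forall>x\<in>V. energy_ext f x = f x) \<and> E 1 (energy_ext f) = E0 f"
    unfolding energy_ext_def by (rule someI_ex[OF E1_attained])
  then show "p \<in> V \<Longrightarrow> energy_ext f p = f p" "E 1 (energy_ext f) = E0 f" by auto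
qed

definition child_data :: "nat \<Rightarrow> ('a \<Rightarrow> real) \<Rightarrow> 'a \<Rightarrow> real" where
  "child_data i f = energy_ext f \<circ> \<psi> i"

lemma child_data_energy: "i \<in> I \<Longrightarrow> E0 (child_data i f) \<le> rmax * E0 f"
  using E_child[of i 0 "energy_ext f"] energy_ext(2)[of f] mult_right_mono[OF rmax(3) E0_nonneg[of f]]
  by (fastforce simp: E_0 child_data_def)

text \<open>The boundary values on the cell of the first \<open>n\<close> letters of \<open>w\<close> of the function obtained from the boundary
values \<open>f\<close> by repeated minimal extension, pulled back to \<open>V\<close>.\<close>

primrec word_data :: "('a \<Rightarrow> real) \<Rightarrow> (nat \<Rightarrow> nat) \<Rightarrow> nat \<Rightarrow> 'a \<Rightarrow> real" where
  "word_data f w 0 = f"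
| "word_data f w (Suc n) = child_data (w n) (word_data f w n)"

lemma word_data_shift: "word_data f w (Suc n) = word_data (child_data (w 0) f) (shift w) n"
  by (induction n) (simp_all add: shift_def)

lemma word_data_energy: "w \<in> inf_words M \<Longrightarrow> E0 (word_data f w n) \<le> rmax ^ n * E0 f"
proof (induction n)
  case (Suc n)
  have "E0 (word_data f w (Suc n)) \<le> rmax * E0 (word_data f w n)"
    using child_data_energy[OF inf_words_hd[OF Suc.prems]] by simp
  also have "\<dots> \<le> rmax * (rmax ^ n * E0 f)" using Suc rmax by (intro mult_left_mono) auto
  finally show ?case by simp
qed simp

definition base_point :: 'a where "base_point = (SOME p. p \<in> V)"

lemma base_point: "base_point \<in> V"
  unfolding base_point_def using V_nonempty by (simp add: some_in_eq)

definition harmonic_limit :: "('a \<Rightarrow> real) \<Rightarrow> (nat \<Rightarrow> nat) \<Rightarrow> real" where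
  "harmonic_limit f w = lim (\<lambda>n. word_data f w n base_point)"

definition harmonic_osc_const :: real where "harmonic_osc_const = osc_const + sqrt level1_const"

lemma harmonic_osc_const_nonneg: "0 \<le> harmonic_osc_const"
  unfolding harmonic_osc_const_def using osc_const_nonneg level1_const(1) by simp

lemma harmonic_limit_tendsto:
  assumes w: "w \<in> inf_words M"
  shows "(\<lambda>n. word_data f w n base_point) \<longlonglongrightarrow> harmonic_limit f w" "\<bar>f base_point - harmonic_limit f w\<bar> \<le> osc_const * sqrt (E0 f)"
proof -
  have 1: "E 1 (energy_ext (word_data f w n)) \<le> rmax ^ n * E0 f" for n
    using word_data_energy[OF w] energy_ext(2) by simp
  have 2: "energy_ext (word_data f w n) (\<psi> (w n) base_point) = energy_ext (word_data f w (Suc n)) base_point" for n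
    using energy_ext(1)[OF base_point] by (simp add: child_data_def)
  note c = chain_along_word[where g="\<lambda>n. energy_ext (word_data f w n)" and w=w, OF inf_words_hd[OF w] base_point E0_nonneg 1 2]
  show "(\<lambda>n. word_data f w n base_point) \<longlonglongrightarrow> harmonic_limit f w"
    using c(1) energy_ext(1)[OF base_point] by (simp add: convergent_LIMSEQ_iff harmonic_limit_def)
  show "\<bar>f base_point - harmonic_limit f w\<bar> \<le> osc_const * sqrt (E0 f)"
    using c(2) energy_ext(1)[OF base_point] by (simp add: harmonic_limit_def)
qed

text \<open>The chain of \<open>harmonic_limit_tendsto\<close> starts at the base point; other boundary points are compared with
the base point at level one.\<close>

lemma harmonic_limit_near_boundary:
  assumes w: "w \<in> inf_words M" and p: "p \<in> V"
  shows "\<bar>f p - harmonic_limit f w\<bar> \<le> harmonic_osc_const * sqrt (E0 f)"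
proof -
  have V1: "p \<in> (\<Union>i\<in>I. \<psi> i ` V)" if "p \<in> V" for p by (rule boundary_cover[OF that]) auto
  have "(energy_ext f p - energy_ext f base_point)\<^sup>2 \<le> level1_const * E 1 (energy_ext f)" by (intro level1_const(2) V1 p base_point)
  then have "(f p - f base_point)\<^sup>2 \<le> level1_const * E0 f" using energy_ext p base_point by simp
  then have "\<bar>f p - f base_point\<bar> \<le> sqrt level1_const * sqrt (E0 f)"
    by (auto dest: real_sqrt_le_mono simp: real_sqrt_mult)
  with harmonic_limit_tendsto(2)[OF w, of f] show ?thesis
    unfolding harmonic_osc_const_def by (simp add: distrib_right)
qed

lemma harmonic_limit_shift:
  assumes w: "w \<in> inf_words M"
  shows "harmonic_limit f w = harmonic_limit (child_data (w 0) f) (shift w)"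
proof -
  have "(\<lambda>n. word_data f w (Suc n) base_point) \<longlonglongrightarrow> harmonic_limit f w" using harmonic_limit_tendsto(1)[OF w] by (rule LIMSEQ_Suc)
  moreover have "(\<lambda>n. word_data f w (Suc n) base_point) \<longlonglongrightarrow> harmonic_limit (child_data (w 0) f) (shift w)"
    unfolding word_data_shift by (rule harmonic_limit_tendsto(1)[OF inf_words_shift[OF w]])
  ultimately show ?thesis by (rule LIMSEQ_unique)
qed

text \<open>Along the address of a boundary point the extension always takes the value prescribed at that
point, so the error bound of \<open>harmonic_limit_near_boundary\<close> can be applied at every level, where the energy has
decayed.\<close>

lemma harmonic_limit_post_critical:
  assumes "v \<in> post_critical M F \<psi>"
  shows "harmonic_limit f v = f (coding F \<psi> v)"
proof -
  have bound: "\<bar>f (coding F \<psi> v) - harmonic_limit f v\<bar> \<le> harmonic_osc_const * sqrt (rmax ^ n * E0 f)"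
    if "v \<in> post_critical M F \<psi>" for n f v
    using that
  proof (induction n arbitrary: f v)
    case 0
    then show ?case using harmonic_limit_near_boundary[OF _ coding_boundary] post_critical_inf_words by auto
  next
    case (Suc n)
    have v: "v \<in> inf_words M" using Suc.prems post_critical_inf_words by blast
    have "f (coding F \<psi> v) = energy_ext f (\<psi> (v 0) (coding F \<psi> (shift v)))"
      using energy_ext(1)[OF coding_boundary[OF Suc.prems]] coding_shift[OF v] by simp
    then have "\<bar>f (coding F \<psi> v) - harmonic_limit f v\<bar> = \<bar>child_data (v 0) f (coding F \<psi> (shift v)) - harmonic_limit (child_data (v 0) f) (shift v)\<bar>"
      using harmonic_limit_shift[OF v, of f] by (simp add: child_data_def)
    also have "\<dots> \<le> harmonic_osc_const * sqrt (rmax ^ n * E0 (child_data (v 0) f))"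
      by (intro Suc.IH post_critical_shift Suc.prems)
    also have "\<dots> \<le> harmonic_osc_const * sqrt (rmax ^ n * (rmax * E0 f))"
      using rmax harmonic_osc_const_nonneg child_data_energy[OF inf_words_hd[OF v]]
      by (intro mult_left_mono real_sqrt_le_mono) auto
    finally show ?case by (simp add: mult_ac)
  qed
  have "(\<lambda>n. harmonic_osc_const * sqrt (rmax ^ n * E0 f)) \<longlonglongrightarrow> harmonic_osc_const * sqrt (0 * E0 f)"
    by (intro tendsto_intros) (use rmax in auto)
  then have "\<bar>f (coding F \<psi> v) - harmonic_limit f v\<bar> \<le> harmonic_osc_const * sqrt (0 * E0 f)"
    by (rule LIMSEQ_le_const) (use bound[OF assms] in blast)
  then show ?thesis by simp
qed

text \<open>Well-definedness of the harmonic function on \<open>F\<close>. Up to the first letter in which two addresses of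
the same point differ, both limits are computed alike. At that letter the remaining point belongs
to two cells, so the shifted addresses are post-critical and both limits equal the
value of the same minimal extension at that point.\<close>

lemma harmonic_limit_coding:
  assumes "w \<in> inf_words M" "w' \<in> inf_words M" "coding F \<psi> w = coding F \<psi> w'"
  shows "harmonic_limit f w = harmonic_limit f w'"
proof (cases "w = w'")
  case False
  have "harmonic_limit f w = harmonic_limit f w'" if "\<And>k. k < n \<Longrightarrow> w k = w' k" "w n \<noteq> w' n"
    "w \<in> inf_words M" "w' \<in> inf_words M" "coding F \<psi> w = coding F \<psi> w'" for n
    using that
  proof (induction n arbitrary: f w w')
    case 0
    note w = \<open>w \<in> inf_words M\<close> and w' = \<open>w' \<in> inf_words M\<close>
    have in_cells: "coding F \<psi> w \<in> \<psi> (w 0) ` F" "coding F \<psi> w' \<in> \<psi> (w' 0) ` F"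
      using coding_shift[OF w] coding_shift[OF w'] coding_in inf_words_shift w w' by blast+
    have P: "shift w \<in> post_critical M F \<psi>" "shift w' \<in> post_critical M F \<psi>"
      using in_cells 0 inf_words_hd[OF w] inf_words_hd[OF w']
        post_critical_base[of w "w 0" "w' 0"] post_critical_base[of w' "w 0" "w' 0"] by simp_all
    have "harmonic_limit f u = energy_ext f (coding F \<psi> u)" if "u \<in> inf_words M" "shift u \<in> post_critical M F \<psi>" for u
      using harmonic_limit_shift[OF that(1), of f] harmonic_limit_post_critical[OF that(2), of "child_data (u 0) f"] coding_shift[OF that(1)]
      by (simp add: child_data_def)
    then show ?case using w w' P 0 by simp
  next
    case (Suc n)
    note w = \<open>w \<in> inf_words M\<close> and w' = \<open>w' \<in> inf_words M\<close>
    have hd: "w 0 = w' 0" using Suc.prems(1)[of 0] by simp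
    have "\<psi> (w 0) (coding F \<psi> (shift w)) = \<psi> (w 0) (coding F \<psi> (shift w'))"
      using Suc.prems(5) coding_shift[OF w] coding_shift[OF w'] hd by simp
    then have eq: "coding F \<psi> (shift w) = coding F \<psi> (shift w')"
      using inj_onD[OF inj_\<psi>[OF inf_words_hd[OF w]]] coding_in[OF inf_words_shift] w w' by blast
    have "harmonic_limit (child_data (w 0) f) (shift w) = harmonic_limit (child_data (w 0) f) (shift w')"
    proof (rule Suc.IH)
      show "shift w k = shift w' k" if "k < n" for k using Suc.prems(1)[of "Suc k"] that by (simp add: shift_def)
      show "shift w n \<noteq> shift w' n" using Suc.prems(2) by (simp add: shift_def)
    qed (use w w' eq inf_words_shift in auto)
    then show ?case using harmonic_limit_shift[OF w, of f] harmonic_limit_shift[OF w', of f] hd by simp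
  qed
  note first_difference = this
  obtain k where "w k \<noteq> w' k" using False by blast
  define n where "n = (LEAST k. w k \<noteq> w' k)"
  have "w n \<noteq> w' n" unfolding n_def by (rule LeastI[of _ k]) fact
  moreover have "w k = w' k" if "k < n" for k using not_less_Least that unfolding n_def by blast
  ultimately show ?thesis using first_difference[of n] assms by blast
qed simp

definition harmonic_ext :: "('a \<Rightarrow> real) \<Rightarrow> 'a \<Rightarrow> real" where
  "harmonic_ext f x = harmonic_limit f (SOME w. w \<in> inf_words M \<and> coding F \<psi> w = x)"

lemma harmonic_ext_coding:
  assumes w: "w \<in> inf_words M"
  shows "harmonic_ext f (coding F \<psi> w) = harmonic_limit f w"
proof -
  define v where "v = (SOME v. v \<in> inf_words M \<and> coding F \<psi> v = coding F \<psi> w)"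
  have "v \<in> inf_words M \<and> coding F \<psi> v = coding F \<psi> w"
    unfolding v_def by (rule someI[of _ w]) (use w in simp)
  then show ?thesis using harmonic_limit_coding[of v w f] w by (simp only: harmonic_ext_def v_def[symmetric])
qed

lemma harmonic_ext_child:
  assumes "i \<in> I" "x \<in> F"
  shows "harmonic_ext f (\<psi> i x) = harmonic_ext (child_data i f) x"
proof -
  obtain v where v: "v \<in> inf_words M" "coding F \<psi> v = x" using coding_surj[OF assms(2)] .
  note c = coding_Cons[OF v(1) assms(1)]
  show ?thesis
    using harmonic_ext_coding[OF c(1), of f] harmonic_ext_coding[OF v(1), of "child_data i f"] harmonic_limit_shift[OF c(1), of f] c v(2) by simp
qed

lemma harmonic_ext_boundary: assumes "p \<in> V" shows "harmonic_ext f p = f p"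
proof -
  obtain v where v: "v \<in> post_critical M F \<psi>" "p = coding F \<psi> v" using assms unfolding boundary0_def by blast
  then show ?thesis using harmonic_ext_coding[of v f] harmonic_limit_post_critical[OF v(1), of f] post_critical_inf_words by auto
qed

lemma harmonic_ext_osc:
  assumes "x \<in> F" "y \<in> F"
  shows "\<bar>harmonic_ext f x - harmonic_ext f y\<bar> \<le> 2 * harmonic_osc_const * sqrt (E0 f)"
proof -
  obtain v where v: "v \<in> inf_words M" "coding F \<psi> v = x" using coding_surj[OF assms(1)] .
  obtain w where w: "w \<in> inf_words M" "coding F \<psi> w = y" using coding_surj[OF assms(2)] .
  show ?thesis
    using harmonic_limit_near_boundary[OF v(1) base_point, of f] harmonic_limit_near_boundary[OF w(1) base_point, of f] harmonic_ext_coding[OF v(1), of f] harmonic_ext_coding[OF w(1), of f] v w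
    by simp
qed

lemma harmonic_ext_cell:
  "set w \<subseteq> I \<Longrightarrow> \<exists>g. E0 g \<le> rmax ^ length w * E0 f \<and> (\<forall>x\<in>F. harmonic_ext f (cmp w x) = harmonic_ext g x)"
proof (induction w arbitrary: f)
  case Nil
  then show ?case by (intro exI[of _ f]) simp
next
  case (Cons i w)
  then have i: "i \<in> I" and w: "set w \<subseteq> I" by auto
  obtain g where g: "E0 g \<le> rmax ^ length w * E0 (child_data i f)" "\<And>x. x \<in> F \<Longrightarrow> harmonic_ext (child_data i f) (cmp w x) = harmonic_ext g x"
    using Cons.IH[OF w] by blast
  have "E0 g \<le> rmax ^ length w * (rmax * E0 f)"
    using g(1) child_data_energy[OF i, of f] rmax(1)
    by (meson mult_left_mono order_trans zero_le_power less_imp_le)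
  moreover have "harmonic_ext f (cmp (i # w) x) = harmonic_ext g x" if "x \<in> F" for x
    using harmonic_ext_child[OF i cmp_in[OF w that], of f] g(2)[OF that] by simp
  ultimately show ?case by (intro exI[of _ g]) (simp add: mult_ac)
qed

lemma harmonic_ext_continuous: "continuous_on F (harmonic_ext f)"
proof (rule continuous_if_small_osc_on_cells)
  fix e :: real assume e: "0 < e"
  have "(\<lambda>n. 2 * harmonic_osc_const * sqrt (rmax ^ n * E0 f)) \<longlonglongrightarrow> 2 * harmonic_osc_const * sqrt (0 * E0 f)"
    by (intro tendsto_intros) (use rmax in auto)
  then obtain n where n: "2 * harmonic_osc_const * sqrt (rmax ^ n * E0 f) < e"
    using order_tendstoD(2)[of _ _ sequentially e] e by (fastforce simp: eventually_sequentially)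
  have "\<bar>harmonic_ext f (cmp w x) - harmonic_ext f (cmp w y)\<bar> < e" if w: "w \<in> words M n" and xy: "x \<in> F" "y \<in> F" for w x y
  proof -
    obtain g where g: "E0 g \<le> rmax ^ n * E0 f" "\<And>x. x \<in> F \<Longrightarrow> harmonic_ext f (cmp w x) = harmonic_ext g x"
      using harmonic_ext_cell[OF words_set[OF w], of f] words_length[OF w] by auto
    have "\<bar>harmonic_ext g x - harmonic_ext g y\<bar> \<le> 2 * harmonic_osc_const * sqrt (E0 g)" by (intro harmonic_ext_osc xy)
    also have "\<dots> \<le> 2 * harmonic_osc_const * sqrt (rmax ^ n * E0 f)"
      using g harmonic_osc_const_nonneg by (intro mult_left_mono real_sqrt_le_mono) auto
    also have "\<dots> < e" by (rule n)
    finally show ?thesis using g xy by simp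
  qed
  then show "\<exists>n. \<forall>w\<in>words M n. \<forall>x\<in>F. \<forall>y\<in>F. \<bar>harmonic_ext f (cmp w x) - harmonic_ext f (cmp w y)\<bar> < e" by blast
qed

text \<open>The minimal extension preserves the energy by the compatibility of the harmonic structure, so the
energies are constant in the level.\<close>

lemma harmonic_ext_energy: "E n (harmonic_ext f) = E0 f"
proof (induction n arbitrary: f)
  case 0
  then show ?case unfolding E_0 by (intro E0_cong harmonic_ext_boundary)
next
  case (Suc n)
  have "E n (harmonic_ext f \<circ> \<psi> i) = E0 (child_data i f)" if "i \<in> I" for i
  proof -
    have "E n (harmonic_ext f \<circ> \<psi> i) = E n (harmonic_ext (child_data i f))" using harmonic_ext_child[OF that] by (intro E_cong) simp
    then show ?thesis using Suc by simp
  qed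
  then have "E (Suc n) (harmonic_ext f) = (\<Sum>i\<in>I. inverse (r i) * E0 (energy_ext f \<circ> \<psi> i))"
    unfolding E_Suc by (intro sum.cong) (auto simp: child_data_def)
  then show ?case using energy_ext(2)[of f] E_1[of "energy_ext f"] by simp
qed

lemma harmonic_ext_in_D: "harmonic_ext f \<in> D"
  unfolding dirichlet_domain_def using harmonic_ext_continuous harmonic_ext_energy by (simp add: convergent_const)

text \<open>Functions on the cells that agree at common points form a function of the domain: continuity
passes to the finite union of closed cells, and the energies add up by \<open>E_Suc\<close>.\<close>

lemma glue_cells:
  assumes h: "\<And>i. i \<in> I \<Longrightarrow> h i \<in> D"
    and compat: "\<And>i j x y. i \<in> I \<Longrightarrow> j \<in> I \<Longrightarrow> x \<in> F \<Longrightarrow> y \<in> F \<Longrightarrow> \<psi> i x = \<psi> j y \<Longrightarrow> h i x = h j y"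
  shows "\<exists>g\<in>D. \<forall>i\<in>I. \<forall>x\<in>F. g (\<psi> i x) = h i x"
proof -
  define g where "g z = (SOME c. \<exists>i\<in>I. \<exists>x\<in>F. z = \<psi> i x \<and> c = h i x)" for z
  have g: "g (\<psi> i x) = h i x" if i: "i \<in> I" and x: "x \<in> F" for i x
    unfolding g_def
  proof (rule some_equality)
    show "\<exists>i'\<in>I. \<exists>x'\<in>F. \<psi> i x = \<psi> i' x' \<and> h i x = h i' x'" using i x by blast
  next
    fix c assume "\<exists>i'\<in>I. \<exists>x'\<in>F. \<psi> i x = \<psi> i' x' \<and> c = h i' x'"
    then obtain i' x' where "i' \<in> I" "x' \<in> F" "\<psi> i x = \<psi> i' x'" "c = h i' x'" by auto
    then show "c = h i x" using compat[OF i _ x, of i' x'] by simp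
  qed
  have cont_cell: "continuous_on (\<psi> i ` F) g" if i: "i \<in> I" for i
  proof -
    have "continuous_on (\<psi> i ` F) (inv_into F (\<psi> i))"
      using cont_cmp[of "[i]"] i pcf_facts(3) inj_\<psi>[OF i] by (intro continuous_on_inv) auto
    moreover have "continuous_on F (h i)" using h[OF i] unfolding dirichlet_domain_def by simp
    ultimately have "continuous_on (\<psi> i ` F) (h i \<circ> inv_into F (\<psi> i))"
      using inj_\<psi>[OF i] by (intro continuous_on_compose) (auto simp: inv_into_image_cancel)
    moreover have "(h i \<circ> inv_into F (\<psi> i)) z = g z" if "z \<in> \<psi> i ` F" for z
      using that g[OF i] inj_\<psi>[OF i] by auto
    ultimately show ?thesis by (simp cong: continuous_on_cong)
  qed
  have "continuous_on (\<Union>i\<in>I. \<psi> i ` F) g"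
  proof (rule continuous_on_closed_Union)
    show "closed (\<psi> i ` F)" if "i \<in> I" for i using compact_imp_closed[OF compact_cell[of "[i]"]] that by simp
  qed (use cont_cell in auto)
  then have "continuous_on F g" using pcf_facts(5) by simp
  moreover have "convergent (\<lambda>n. E n g)"
  proof -
    have "E (Suc n) g = (\<Sum>i\<in>I. inverse (r i) * E n (h i))" for n
      unfolding E_Suc using g by (intro sum.cong refl arg_cong[where f="\<lambda>t. _ * t"] E_cong) simp
    moreover have "convergent (\<lambda>n. \<Sum>i\<in>I. inverse (r i) * E n (h i))"
      using h unfolding dirichlet_domain_def
      by (intro convergent_sum convergent_mult convergent_const) auto
    ultimately show ?thesis using convergent_Suc_iff[of "\<lambda>n. E n g"] by simp
  qed
  ultimately show ?thesis using g unfolding dirichlet_domain_def by (intro bexI[of _ g]) auto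
qed

text \<open>The second conjunct is what makes these functions useful: prescribing constant vertex values on a
cell makes the function constant on the whole cell, because harmonic functions with constant boundary
values have energy zero. In the induction step the pieces on two cells match since shared points
are boundary points of both.\<close>

lemma piecewise_harmonic:
  "\<exists>h\<in>D. (\<forall>w\<in>words M n. \<forall>p\<in>V. h (cmp w p) = u (cmp w p)) \<and>
      (\<forall>w\<in>words M n. \<forall>c. (\<forall>p\<in>V. u (cmp w p) = c) \<longrightarrow> (\<forall>z\<in>F. h (cmp w z) = c))"
proof (induction n arbitrary: u)
  case 0
  have "harmonic_ext u z = c" if c: "\<forall>p\<in>V. u p = c" and z: "z \<in> F" for c z
  proof -
    have "E0 u = E0 (\<lambda>_. c)" using c by (intro E0_cong) simp
    also have "\<dots> = 0" by (simp add: E0_eq)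
    finally have "harmonic_ext u z = harmonic_ext u base_point" using harmonic_ext_osc[of z base_point u] z base_point V_sub by auto
    then show ?thesis using harmonic_ext_boundary[OF base_point, of u] c base_point by simp
  qed
  then show ?case using harmonic_ext_in_D harmonic_ext_boundary by (intro bexI[of _ "harmonic_ext u"]) (auto simp: words_0)
next
  case (Suc n)
  have "\<forall>i. \<exists>h. h \<in> D \<and> (\<forall>w\<in>words M n. \<forall>p\<in>V. h (cmp w p) = (u \<circ> \<psi> i) (cmp w p)) \<and>
      (\<forall>w\<in>words M n. \<forall>c. (\<forall>p\<in>V. (u \<circ> \<psi> i) (cmp w p) = c) \<longrightarrow> (\<forall>z\<in>F. h (cmp w z) = c))"
    using Suc.IH by blast
  from choice[OF this] obtain h where h0: "\<forall>i. h i \<in> D \<and> (\<forall>w\<in>words M n. \<forall>p\<in>V. h i (cmp w p) = (u \<circ> \<psi> i) (cmp w p)) \<and>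
      (\<forall>w\<in>words M n. \<forall>c. (\<forall>p\<in>V. (u \<circ> \<psi> i) (cmp w p) = c) \<longrightarrow> (\<forall>z\<in>F. h i (cmp w z) = c))" ..
  have h: "\<And>i. h i \<in> D" "\<And>i w p. w \<in> words M n \<Longrightarrow> p \<in> V \<Longrightarrow> h i (cmp w p) = u (\<psi> i (cmp w p))"
      "\<And>i w c z. w \<in> words M n \<Longrightarrow> (\<And>p. p \<in> V \<Longrightarrow> u (\<psi> i (cmp w p)) = c) \<Longrightarrow> z \<in> F \<Longrightarrow> h i (cmp w z) = c"
    using h0 unfolding o_apply by blast+
  have on_V: "h i x = u (\<psi> i x)" if x: "x \<in> V" for i x
  proof -
    obtain w p where "w \<in> words M n" "p \<in> V" "x = cmp w p" using V_words[OF x] by blast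
    then show ?thesis using h(2) by simp
  qed
  have "\<exists>g\<in>D. \<forall>i\<in>I. \<forall>x\<in>F. g (\<psi> i x) = h i x"
  proof (rule glue_cells)
    show "h i \<in> D" for i by (rule h)
    fix i j x y assume *: "i \<in> I" "j \<in> I" "x \<in> F" "y \<in> F" "\<psi> i x = \<psi> j y"
    show "h i x = h j y"
    proof (cases "i = j")
      case True
      then show ?thesis using inj_onD[OF inj_\<psi>[OF *(1)]] * by auto
    next
      case False
      then have "x \<in> V" "y \<in> V" using cells_inter[of i j x y] cells_inter[of j i y x] * by auto
      then show ?thesis using on_V * by simp
    qed
  qed
  then obtain g where g: "g \<in> D" "\<And>i x. i \<in> I \<Longrightarrow> x \<in> F \<Longrightarrow> g (\<psi> i x) = h i x" by blast
  have split: "\<exists>i w'. w = i # w' \<and> i \<in> I \<and> w' \<in> words M n" if "w \<in> words M (Suc n)" for w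
    using that unfolding words_Suc by auto
  have 1: "g (cmp w p) = u (cmp w p)" if w: "w \<in> words M (Suc n)" and p: "p \<in> V" for w p
  proof -
    obtain i w' where w': "w = i # w'" "i \<in> I" "w' \<in> words M n" using split[OF w] by blast
    then show ?thesis using g(2)[OF w'(2) cmp_in[OF words_set[OF w'(3)]], of p] h(2)[OF w'(3) p] V_sub p by auto
  qed
  have 2: "g (cmp w z) = c" if w: "w \<in> words M (Suc n)" and c: "\<And>p. p \<in> V \<Longrightarrow> u (cmp w p) = c" and z: "z \<in> F" for w c z
  proof -
    obtain i w' where w': "w = i # w'" "i \<in> I" "w' \<in> words M n" using split[OF w] by blast
    then show ?thesis using g(2)[OF w'(2) cmp_in[OF words_set[OF w'(3)] z]] h(3)[OF w'(3) _ z, of i c] c by simp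
  qed
  show ?case using g(1) 1 2 by (intro bexI[of _ g]) auto
qed

text \<open>Take cells of diameter less than half the distance of \<open>x\<close> and \<open>y\<close>, and the piecewise harmonic
function whose vertex values indicate the complement of a ball around \<open>x\<close>. The vertices of a cell containing
\<open>x\<close> lie inside that ball, those of a cell containing \<open>y\<close> outside.\<close>

lemma dirichlet_domain_separates:
  assumes "x \<in> F" "y \<in> F" "x \<noteq> y"
  obtains h where "h \<in> D" "h x = 0" "h y = 1"
proof -
  define d where "d = dist x y / 2"
  have d: "0 < d" using assms by (simp add: d_def)
  obtain N where N: "\<And>w x y. length w \<ge> N \<Longrightarrow> set w \<subseteq> I \<Longrightarrow> x \<in> F \<Longrightarrow> y \<in> F \<Longrightarrow> dist (cmp w x) (cmp w y) < d"
    using cells_shrink[OF d] by blast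
  define u :: "'a \<Rightarrow> real" where "u z = (if dist x z < d then 0 else 1)" for z
  obtain h where h: "h \<in> D"
    "\<And>w c z. w \<in> words M N \<Longrightarrow> (\<forall>p\<in>V. u (cmp w p) = c) \<Longrightarrow> z \<in> F \<Longrightarrow> h (cmp w z) = c"
    using piecewise_harmonic[of N u] by blast
  have near_value: "h z = c" if z: "z \<in> F" and c: "\<And>p. p \<in> F \<Longrightarrow> dist z p < d \<Longrightarrow> u p = c" for z c
  proof -
    obtain w z' where w: "w \<in> words M N" "z' \<in> F" "z = cmp w z'" using F_words[OF z] by blast
    have "u (cmp w p) = c" if "p \<in> V" for p
    proof (rule c)
      have "p \<in> F" using that V_sub by blast
      then show "cmp w p \<in> F" "dist z (cmp w p) < d"
        using cmp_in[OF words_set[OF w(1)]] N[of w z' p] words_length[OF w(1)] words_set[OF w(1)] w by auto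
    qed
    then show ?thesis using h(2)[OF w(1) _ w(2)] w(3) by blast
  qed
  have "h x = 0" by (rule near_value[OF assms(1)]) (simp add: u_def)
  moreover have "h y = 1"
  proof (rule near_value[OF assms(2)])
    fix p assume "dist y p < d"
    then show "u p = 1" using dist_triangle2[of x y p] by (auto simp: u_def d_def)
  qed
  ultimately show ?thesis using that h(1) by blast
qed

section \<open>The resistance metric\<close>

abbreviation R :: "'a \<Rightarrow> 'a \<Rightarrow> real" where "R \<equiv> resistance M F \<psi> A r"
abbreviation EE :: "('a \<Rightarrow> real) \<Rightarrow> real" where "EE f \<equiv> dirichlet_form M F \<psi> A r f f"

lemma D_cont: "f \<in> D \<Longrightarrow> continuous_on F f"
  by (simp add: dirichlet_domain_def)

lemma D_lim: "f \<in> D \<Longrightarrow> (\<lambda>n. E n f) \<longlonglongrightarrow> EE f"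
  by (simp add: dirichlet_domain_def dirichlet_form_def convergent_LIMSEQ_iff)

lemma E_le_EE: "f \<in> D \<Longrightarrow> E n f \<le> EE f"
  using incseq_le[OF _ D_lim] E_mono by (simp add: incseq_def)

lemma EE_nonneg: "f \<in> D \<Longrightarrow> 0 \<le> EE f"
  using E_nonneg[of 0 f] E_le_EE[of f 0] by linarith

text \<open>The summand 1 makes the constant positive, so that it can be divided by.\<close>

definition \<kappa> :: real where "\<kappa> = (2 * osc_const)\<^sup>2 + 1"

lemma \<kappa>_pos: "0 < \<kappa>"
  unfolding \<kappa>_def by (simp add: add_nonneg_pos)

text \<open>Apply \<open>energy_osc\<close> to the pullback of \<open>f\<close> to the cell, whose energies are at most \<open>r_word w\<close>
times those of \<open>f\<close>.\<close>

lemma cell_osc: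
  assumes f: "f \<in> D" and w: "set w \<subseteq> I" and xy: "x \<in> F" "y \<in> F"
  shows "(f (cmp w x) - f (cmp w y))\<^sup>2 \<le> \<kappa> * r_word w * EE f"
proof -
  have cont: "continuous_on F (f \<circ> cmp w)"
    using continuous_on_subset[OF D_cont[OF f], of "cmp w ` F"] cmp_in[OF w]
    by (intro continuous_on_compose cont_cmp w) auto
  have bound: "E n (f \<circ> cmp w) \<le> r_word w * EE f" for n
    using E_cell[OF w, of n f] mult_left_mono[OF E_le_EE[OF f] less_imp_le[OF r_word_pos[OF w]]]
    by (meson order_trans)
  have "(f (cmp w x) - f (cmp w y))\<^sup>2 \<le> (2 * osc_const)\<^sup>2 * (r_word w * EE f)"
    using energy_osc[OF cont bound xy] by simp
  also have "\<dots> \<le> \<kappa> * (r_word w * EE f)"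
    using r_word_pos[OF w] EE_nonneg[OF f] by (intro mult_right_mono) (auto simp: \<kappa>_def)
  finally show ?thesis by (simp add: mult_ac)
qed

lemma E_affine: "E n (\<lambda>z. (f z - a) / b) = E n f / b\<^sup>2"
proof -
  have "E0 (\<lambda>z. (g z - a) / b) = E0 g / b\<^sup>2" for g
  proof -
    have "((g x - a) / b - (g y - a) / b)\<^sup>2 = (g x - g y)\<^sup>2 / b\<^sup>2" for x y
      by (simp add: diff_divide_distrib[symmetric] power_divide)
    then show ?thesis by (simp add: E0_eq sum_divide_distrib mult.commute)
  qed
  then show ?thesis unfolding energy_def by (simp add: o_def sum_divide_distrib)
qed

lemma D_affine:
  assumes f: "f \<in> D" and "b \<noteq> 0"
  shows "(\<lambda>z. (f z - a) / b) \<in> D" "EE (\<lambda>z. (f z - a) / b) = EE f / b\<^sup>2"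
proof -
  have lim: "(\<lambda>n. E n (\<lambda>z. (f z - a) / b)) \<longlonglongrightarrow> EE f / b\<^sup>2"
    unfolding E_affine using \<open>b \<noteq> 0\<close> by (intro tendsto_intros D_lim f) auto
  then show "EE (\<lambda>z. (f z - a) / b) = EE f / b\<^sup>2" unfolding dirichlet_form_def by (rule limI)
  have "continuous_on F (\<lambda>z. (f z - a) / b)" using \<open>b \<noteq> 0\<close> by (intro continuous_intros D_cont f) auto
  then show "(\<lambda>z. (f z - a) / b) \<in> D" using lim by (simp add: dirichlet_domain_def convergentI)
qed

definition admissible :: "'a \<Rightarrow> 'a \<Rightarrow> real set" where
  "admissible x y = {EE f | f. f \<in> D \<and> f x = 0 \<and> f y = 1}"

lemma R_eq: "x \<noteq> y \<Longrightarrow> R x y = inverse (Inf (admissible x y))"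
  by (simp add: resistance_def admissible_def)

lemma admissible_nonempty: "x \<in> F \<Longrightarrow> y \<in> F \<Longrightarrow> x \<noteq> y \<Longrightarrow> admissible x y \<noteq> {}"
  using dirichlet_domain_separates[of x y] unfolding admissible_def by blast

text \<open>Together with \<open>increment_le_R\<close> this characterises \<open>R x y\<close> as a best constant. Non-emptiness of the set of
admissible energies is essential: the infimum over the empty set has no
meaning.\<close>

lemma R_le:
  assumes xy: "x \<in> F" "y \<in> F" "x \<noteq> y" and "0 < c"
    and bound: "\<And>f. f \<in> D \<Longrightarrow> f x = 0 \<Longrightarrow> f y = 1 \<Longrightarrow> 1 \<le> c * EE f"
  shows "R x y \<le> c"
proof -
  have "1 / c \<le> Inf (admissible x y)"
  proof (rule cInf_greatest[OF admissible_nonempty[OF xy]])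
    fix e assume "e \<in> admissible x y"
    then show "1 / c \<le> e" using bound \<open>0 < c\<close> by (auto simp: admissible_def field_simps)
  qed
  then have "inverse (Inf (admissible x y)) \<le> inverse (1 / c)"
    using \<open>0 < c\<close> by (intro le_imp_inverse_le) auto
  then show ?thesis using R_eq[OF xy(3)] by simp
qed

lemma admissible_lower:
  assumes xy: "x \<in> F" "y \<in> F" and e: "e \<in> admissible x y"
  shows "1 / \<kappa> \<le> e"
proof -
  obtain f where f: "f \<in> D" "f x = 0" "f y = 1" "e = EE f" using e unfolding admissible_def by blast
  then have "1 \<le> \<kappa> * e" using cell_osc[OF f(1), of "[]" x y] xy by simp
  then show ?thesis using \<kappa>_pos by (simp add: field_simps)
qed

lemma Inf_admissible_pos:
  assumes xy: "x \<in> F" "y \<in> F" "x \<noteq> y"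
  shows "0 < Inf (admissible x y)"
proof -
  have "1 / \<kappa> \<le> Inf (admissible x y)"
    by (rule cInf_greatest[OF admissible_nonempty[OF xy]]) (rule admissible_lower[OF xy(1,2)])
  moreover have "0 < 1 / \<kappa>" using \<kappa>_pos by simp
  ultimately show ?thesis by linarith
qed

lemma R_pos: "x \<in> F \<Longrightarrow> y \<in> F \<Longrightarrow> x \<noteq> y \<Longrightarrow> 0 < R x y"
  using Inf_admissible_pos R_eq by simp

lemma R_refl: "R x x = 0"
  by (simp add: resistance_def)

lemma R_nonneg: "x \<in> F \<Longrightarrow> y \<in> F \<Longrightarrow> 0 \<le> R x y"
  using R_pos[of x y] by (cases "x = y") (auto simp: R_refl)

text \<open>An affine change of values turns \<open>f\<close> into a function with the values 0 and 1 at \<open>x\<close> and \<open>y\<close>.\<close>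

lemma increment_le_R:
  assumes f: "f \<in> D" and xy: "x \<in> F" "y \<in> F"
  shows "(f x - f y)\<^sup>2 \<le> R x y * EE f"
proof (cases "f x = f y")
  case True
  then show ?thesis using R_nonneg[OF xy] EE_nonneg[OF f] by simp
next
  case False
  then have ne: "x \<noteq> y" by auto
  define b where "b = f y - f x"
  have b: "b \<noteq> 0" using False by (simp add: b_def)
  have "(f y - f x) / b = 1" using b by (simp add: b_def)
  then have "EE f / b\<^sup>2 \<in> admissible x y"
    unfolding admissible_def using D_affine[OF f b, of "f x"]
    by (intro CollectI exI[of _ "\<lambda>z. (f z - f x) / b"]) simp
  moreover have "bdd_below (admissible x y)"
    using admissible_lower[OF xy] by (rule bdd_belowI)
  ultimately have "Inf (admissible x y) \<le> EE f / b\<^sup>2" by (rule cInf_lower)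
  then have "b\<^sup>2 \<le> inverse (Inf (admissible x y)) * EE f"
    using Inf_admissible_pos[OF xy ne] b by (simp add: field_simps)
  then show ?thesis using R_eq[OF ne] by (simp add: b_def power2_commute)
qed

lemma R_commute:
  assumes xy: "x \<in> F" "y \<in> F"
  shows "R x y = R y x"
proof -
  have le: "R x y \<le> R y x" if xy: "x \<in> F" "y \<in> F" for x y
  proof (cases "x = y")
    case False
    show ?thesis
    proof (rule R_le[OF xy False])
      show "0 < R y x" using R_pos[of y x] xy False by auto
      show "1 \<le> R y x * EE f" if "f \<in> D" "f x = 0" "f y = 1" for f
        using increment_le_R[OF that(1) xy(2,1)] that by simp
    qed
  qed simp
  show ?thesis using le[OF xy] le[OF xy(2,1)] by simp
qed

text \<open>Increments of a fixed function add up, and each of them is bounded by \<open>sqrt R\<close> times the square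
root of the energy.\<close>

lemma sqrt_R_triangle:
  assumes F: "x \<in> F" "y \<in> F" "z \<in> F"
  shows "sqrt (R x z) \<le> sqrt (R x y) + sqrt (R y z)"
proof (cases "x = z \<or> x = y")
  case True
  then show ?thesis using R_nonneg F by (auto simp: R_refl)
next
  case False
  let ?c = "(sqrt (R x y) + sqrt (R y z))\<^sup>2"
  have "0 < sqrt (R x y)" using R_pos F False by auto
  then have pos: "0 < sqrt (R x y) + sqrt (R y z)" using R_nonneg[OF F(2,3)] by (intro add_pos_nonneg) auto
  have "R x z \<le> ?c"
  proof (rule R_le)
    show "0 < ?c" using pos by simp
    fix f assume f: "f \<in> D" "f x = 0" "f z = 1"
    have "\<bar>f u - f v\<bar> \<le> sqrt (R u v) * sqrt (EE f)" if "u \<in> F" "v \<in> F" for u v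
      using real_sqrt_le_mono[OF increment_le_R[OF f(1) that]] by (simp add: real_sqrt_mult)
    from this[OF F(1,2)] this[OF F(2,3)]
    have "1 \<le> (sqrt (R x y) + sqrt (R y z)) * sqrt (EE f)"
      using f by (simp add: distrib_right)
    then have "1\<^sup>2 \<le> ((sqrt (R x y) + sqrt (R y z)) * sqrt (EE f))\<^sup>2" by (intro power_mono) auto
    then show "1 \<le> ?c * EE f" using EE_nonneg[OF f(1)] by (simp add: power_mult_distrib)
  qed (use F False in auto)
  then show ?thesis using pos real_le_lsqrt by simp
qed

lemma R_cell:
  assumes w: "set w \<subseteq> I" and xy: "x \<in> cmp w ` F" "y \<in> cmp w ` F"
  shows "R x y \<le> \<kappa> * r_word w"
proof -
  obtain x' y' where *: "x' \<in> F" "x = cmp w x'" "y' \<in> F" "y = cmp w y'" using xy by blast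
  have F: "x \<in> F" "y \<in> F" using * cmp_in[OF w] by auto
  show ?thesis
  proof (cases "x = y")
    case True
    then show ?thesis using \<kappa>_pos r_word_pos[OF w] by (simp add: R_refl)
  next
    case False
    show ?thesis
    proof (rule R_le[OF F False])
      show "0 < \<kappa> * r_word w" using \<kappa>_pos r_word_pos[OF w] by simp
      show "1 \<le> \<kappa> * r_word w * EE f" if "f \<in> D" "f x = 0" "f y = 1" for f
        using cell_osc[OF that(1) w *(1,3)] that * by simp
    qed
  qed
qed

section \<open>Covering numbers of the resistance metric\<close>

definition rmin :: real where "rmin = Min (r ` I)"

lemma rmin: "0 < rmin" "i \<in> I \<Longrightarrow> rmin \<le> r i" "rmin \<le> 1"
proof -
  have ne: "r ` I \<noteq> {}" "1 \<in> I" using pcf_facts(1) by auto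
  show le: "i \<in> I \<Longrightarrow> rmin \<le> r i" for i unfolding rmin_def by (intro Min_le) auto
  show "0 < rmin" unfolding rmin_def using ne r_pos by (subst Min_gr_iff) auto
  show "rmin \<le> 1" using le[OF ne(2)] r_less_1[OF ne(2)] by linarith
qed

text \<open>For each \<open>s\<close> the family consists of the words at which \<open>r_word\<close> first drops to \<open>s\<close> or below. In the
induction a word is split into its first letter \<open>i\<close> and a word of the family for \<open>s / r i\<close>; as this
level may exceed 1, the range of \<open>s\<close> reaches up to \<open>1 / rmin\<close>, and for \<open>s \<ge> 1\<close> the empty word
suffices.\<close>

lemma stopping_words:
  assumes d: "(\<Sum>i\<in>I. r i powr d) = 1"
  shows "rmax ^ n \<le> s \<Longrightarrow> s * rmin \<le> 1 \<Longrightarrow>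
    \<exists>W. finite W \<and> (\<forall>w\<in>W. set w \<subseteq> I \<and> r_word w \<le> s \<and> s * rmin \<le> r_word w) \<and>
        F \<subseteq> (\<Union>w\<in>W. cmp w ` F) \<and> (\<Sum>w\<in>W. r_word w powr d) \<le> 1"
proof (induction n arbitrary: s)
  case 0
  then show ?case by (intro exI[of _ "{[]}"]) auto
next
  case (Suc n)
  show ?case
  proof (cases "1 \<le> s")
    case True
    then show ?thesis using Suc.prems by (intro exI[of _ "{[]}"]) auto
  next
    case False
    have "\<exists>W. finite W \<and> (\<forall>w\<in>W. set w \<subseteq> I \<and> r_word w \<le> s / r i \<and> s / r i * rmin \<le> r_word w) \<and>
        F \<subseteq> (\<Union>w\<in>W. cmp w ` F) \<and> (\<Sum>w\<in>W. r_word w powr d) \<le> 1" if i: "i \<in> I" for i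
    proof (rule Suc.IH)
      \<comment> \<open>Passing from \<open>s\<close> to \<open>s / r i\<close> lowers the induction level by one.\<close>
      have "rmax ^ n * r i \<le> rmax ^ n * rmax" using rmax i by (intro mult_left_mono) auto
      also have "\<dots> \<le> s" using Suc.prems by (simp add: mult.commute)
      finally show "rmax ^ n \<le> s / r i" using r_pos[OF i] by (simp add: field_simps)
      have "s * rmin \<le> 1 * r i" using False rmin(1) rmin(2)[OF i] Suc.prems by (intro mult_mono) auto
      then show "s / r i * rmin \<le> 1" using r_pos[OF i] by (simp add: field_simps)
    qed
    then have "\<forall>i\<in>I. \<exists>W. finite W \<and> (\<forall>w\<in>W. set w \<subseteq> I \<and> r_word w \<le> s / r i \<and> s / r i * rmin \<le> r_word w) \<and>
        F \<subseteq> (\<Union>w\<in>W. cmp w ` F) \<and> (\<Sum>w\<in>W. r_word w powr d) \<le> 1" by (rule ballI)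
    from bchoice[OF this] obtain W where
      W0: "\<forall>i\<in>I. finite (W i) \<and> (\<forall>w\<in>W i. set w \<subseteq> I \<and> r_word w \<le> s / r i \<and> s / r i * rmin \<le> r_word w) \<and>
        F \<subseteq> (\<Union>w\<in>W i. cmp w ` F) \<and> (\<Sum>w\<in>W i. r_word w powr d) \<le> 1" ..
    have W: "\<And>i. i \<in> I \<Longrightarrow> finite (W i)" "\<And>i w. i \<in> I \<Longrightarrow> w \<in> W i \<Longrightarrow> set w \<subseteq> I"
       "\<And>i w. i \<in> I \<Longrightarrow> w \<in> W i \<Longrightarrow> r_word w \<le> s / r i" "\<And>i w. i \<in> I \<Longrightarrow> w \<in> W i \<Longrightarrow> s / r i * rmin \<le> r_word w"
       "\<And>i. i \<in> I \<Longrightarrow> F \<subseteq> (\<Union>w\<in>W i. cmp w ` F)" "\<And>i. i \<in> I \<Longrightarrow> (\<Sum>w\<in>W i. r_word w powr d) \<le> 1"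
      using bspec[OF W0] by simp_all
    let ?W = "(\<lambda>(i, w). i # w) ` Sigma I W"
    have inj: "inj_on (\<lambda>(i, w). i # w) (Sigma I W)" by (auto simp: inj_on_def)
    have "(\<Sum>w\<in>?W. r_word w powr d) = (\<Sum>(i, w)\<in>Sigma I W. r_word (i # w) powr d)"
      unfolding sum.reindex[OF inj] by (simp add: case_prod_unfold)
    also have "\<dots> = (\<Sum>i\<in>I. \<Sum>w\<in>W i. r_word (i # w) powr d)"
      using W(1) by (subst sum.Sigma) auto
    also have "\<dots> = (\<Sum>i\<in>I. r i powr d * (\<Sum>w\<in>W i. r_word w powr d))"
      by (simp add: powr_mult sum_distrib_left)
    also have "\<dots> \<le> (\<Sum>i\<in>I. r i powr d * 1)"
      by (intro sum_mono mult_left_mono W(6)) auto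
    finally have sum: "(\<Sum>w\<in>?W. r_word w powr d) \<le> 1" using d by simp
    have "F \<subseteq> (\<Union>w\<in>?W. cmp w ` F)"
    proof
      fix x assume "x \<in> F"
      then obtain i y where iy: "i \<in> I" "y \<in> F" "x = \<psi> i y" by (rule cell_cover)
      then obtain w where "w \<in> W i" "y \<in> cmp w ` F" using W(5)[OF iy(1)] by blast
      then show "x \<in> (\<Union>w\<in>?W. cmp w ` F)" using iy by (intro UN_I[of "i # w"]) force+
    qed
    moreover have "set w \<subseteq> I \<and> r_word w \<le> s \<and> s * rmin \<le> r_word w" if mem: "w \<in> ?W" for w
    proof -
      obtain i v where iv: "i \<in> I" "v \<in> W i" "w = i # v" using mem by auto
      show ?thesis using W(2-4)[OF iv(1,2)] iv r_pos[OF iv(1)] by (simp add: field_simps)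
    qed
    moreover have "finite ?W" using W(1) by (intro finite_imageI finite_SigmaI) auto
    ultimately show ?thesis using sum by (intro exI[of _ ?W]) blast
  qed
qed

text \<open>Each word of the stopping family contributes at least \<open>(s * rmin) powr d\<close> to a sum that is at
most 1.\<close>

lemma covering_by_cells:
  assumes d: "0 \<le> d" "(\<Sum>i\<in>I. r i powr d) = 1" and s: "0 < s" "s \<le> 1"
  obtains W where "finite W" "\<And>w. w \<in> W \<Longrightarrow> set w \<subseteq> I" "\<And>w. w \<in> W \<Longrightarrow> r_word w \<le> s"
    "F \<subseteq> (\<Union>w\<in>W. cmp w ` F)" "real (card W) * (s * rmin) powr d \<le> 1"
proof -
  obtain n where n: "rmax ^ n < s" using real_arch_pow_inv[OF s(1) rmax(2)] by blast
  have "s * rmin \<le> 1 * 1" using s rmin(1,3) by (intro mult_mono) auto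
  then obtain W where W: "finite W" "\<forall>w\<in>W. set w \<subseteq> I \<and> r_word w \<le> s \<and> s * rmin \<le> r_word w"
        "F \<subseteq> (\<Union>w\<in>W. cmp w ` F)" "(\<Sum>w\<in>W. r_word w powr d) \<le> 1"
    using stopping_words[OF d(2), of n s] n by auto
  have "real (card W) * (s * rmin) powr d \<le> (\<Sum>w\<in>W. r_word w powr d)"
    using W(2) d(1) s rmin(1) by (subst sum_constant[symmetric], intro sum_mono powr_mono2) auto
  also have "\<dots> \<le> 1" by (rule W(4))
  finally show ?thesis using that[OF W(1) _ _ W(3)] W(2) by blast
qed

section \<open>Hoelder versions on the resistance space\<close>

text \<open>The Kolmogorov theorem is applied to \<open>\<rho> = sqrt (R / \<kappa>)\<close> with covering exponent \<open>2 * d\<close> and Hoelder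
exponent \<open>2 * \<gamma> / \<beta>\<close>, which is \<open>\<gamma> / \<beta>\<close> with respect to \<open>R\<close>.\<close>

theorem kolmogorov_on_resistance_space:
  fixes \<Omega> :: "'w measure" and \<xi> :: "'a \<Rightarrow> 'w \<Rightarrow> 'e::polish_space" and d C \<beta> \<gamma> :: real
  assumes d: "0 < d" "(\<Sum>i\<in>I. r i powr d) = 1"
    and meas: "is_process \<Omega> F \<xi>" and pos: "0 < C" "0 < \<beta>" "0 < \<gamma>"
    and moment: "\<And>x y. x \<in> F \<Longrightarrow> y \<in> F \<Longrightarrow>
           (\<integral>\<^sup>+\<omega>. ennreal (dist (\<xi> x \<omega>) (\<xi> y \<omega>) powr \<beta>) \<partial>\<Omega>) \<le> ennreal (C * R x y powr (d + \<gamma>))"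
  shows "\<exists>\<eta>. is_version \<Omega> F \<xi> \<eta> \<and>
           (AE \<omega> in \<Omega>. essentially_hoelder F R dist (\<gamma> / \<beta>) (\<lambda>x. \<eta> x \<omega>))"
proof -
  define \<rho> where "\<rho> x y = (if x \<in> F \<and> y \<in> F then sqrt (R x y / \<kappa>) else 0)" for x y
  have \<rho>_F: "\<rho> x y = sqrt (R x y) / sqrt \<kappa>" if "x \<in> F" "y \<in> F" for x y
    using that by (simp add: \<rho>_def real_sqrt_divide)
  have R_powr: "R x y powr e = \<kappa> powr e * \<rho> x y powr (2 * e)" if "x \<in> F" "y \<in> F" for x y e
  proof -
    have "\<rho> x y powr (2 * e) = ((\<rho> x y)\<^sup>2) powr e"
      using R_nonneg[OF that] \<kappa>_pos that by (simp add: \<rho>_def powr_powr[symmetric])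
    also have "(\<rho> x y)\<^sup>2 = R x y / \<kappa>" using R_nonneg[OF that] \<kappa>_pos that by (simp add: \<rho>_def)
    finally show ?thesis using R_nonneg[OF that] \<kappa>_pos by (simp add: powr_mult[symmetric])
  qed
  have metric: "Metric_space F \<rho>"
  proof
    show "0 \<le> \<rho> x y" for x y using R_nonneg[of x y] \<kappa>_pos by (simp add: \<rho>_def)
    show "\<rho> x y = \<rho> y x" for x y using R_commute[of x y] by (simp add: \<rho>_def)
    show "\<rho> x y = 0 \<longleftrightarrow> x = y" if "x \<in> F" "y \<in> F" for x y
      using R_pos[OF that] \<kappa>_pos that by (cases "x = y") (auto simp: \<rho>_F R_refl)
    show "\<rho> x z \<le> \<rho> x y + \<rho> y z" if "x \<in> F" "y \<in> F" "z \<in> F" for x y z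
      using sqrt_R_triangle[OF that] \<kappa>_pos that by (simp add: \<rho>_F add_divide_distrib[symmetric] divide_right_mono)
  qed
  have \<rho>_cell: "\<rho> x y \<le> sqrt (r_word w)" if w: "set w \<subseteq> I" and xy: "x \<in> cmp w ` F" "y \<in> cmp w ` F" for w x y
  proof -
    have "x \<in> F" "y \<in> F" using xy cmp_in[OF w] by auto
    then show ?thesis using R_cell[OF w xy] \<kappa>_pos by (simp add: \<rho>_def divide_le_eq mult.commute)
  qed
  have diam: "\<rho> x y \<le> 1" if "x \<in> F" "y \<in> F" for x y using \<rho>_cell[of "[]" x y] that by simp
  have nets: "\<exists>D\<subseteq>F. finite D \<and> card D \<le> rmin powr - d * 2 powr (2 * d * real n) \<and>
                       (\<forall>x\<in>F. \<exists>u\<in>D. \<rho> x u \<le> (1/2) ^ n)" for n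
  proof -
    have s: "(0::real) < (1/4) ^ n" "(1/4::real) ^ n \<le> 1" by (auto intro: power_le_one)
    obtain W where W: "finite W" "\<And>w. w \<in> W \<Longrightarrow> set w \<subseteq> I" "\<And>w. w \<in> W \<Longrightarrow> r_word w \<le> (1/4) ^ n"
      "F \<subseteq> (\<Union>w\<in>W. cmp w ` F)" "real (card W) * ((1/4) ^ n * rmin) powr d \<le> 1"
      using covering_by_cells[OF less_imp_le[OF d(1)] d(2) s] by blast
    have p0F: "base_point \<in> F" using base_point V_sub by blast
    let ?D = "(\<lambda>w. cmp w base_point) ` W"
    have "((1/4::real) ^ n) powr d = 2 powr (- (2 * d * real n))"
    proof -
      have "(1/4::real) ^ n = (1/2) ^ (2 * n)" by (simp add: power_mult power2_eq_square)
      then show ?thesis using half_power_powr[of "2 * n" d] by (simp add: powr_power mult_ac)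
    qed
    then have "real (card W) * (2 powr (- (2 * d * real n)) * rmin powr d) \<le> 1"
      using W(5) by (simp add: powr_mult)
    then have "real (card W) \<le> rmin powr - d * 2 powr (2 * d * real n)"
      using rmin(1) by (simp add: powr_minus field_simps)
    moreover have "card ?D \<le> card W" using W(1) by (rule card_image_le)
    ultimately have "real (card ?D) \<le> rmin powr - d * 2 powr (2 * d * real n)" by linarith
    moreover have "\<exists>u\<in>?D. \<rho> x u \<le> (1/2) ^ n" if x: "x \<in> F" for x
    proof -
      obtain w where w: "w \<in> W" "x \<in> cmp w ` F" using W(4) x by blast
      have "\<rho> x (cmp w base_point) \<le> sqrt (r_word w)" by (intro \<rho>_cell W(2) w imageI p0F)
      also have "\<dots> \<le> sqrt ((1/4) ^ n)" by (intro real_sqrt_le_mono W(3) w)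
      also have "\<dots> = (1/2) ^ n" by (simp add: real_sqrt_power real_sqrt_divide)
      finally show ?thesis using w(1) by blast
    qed
    moreover have "?D \<subseteq> F" using cmp_in[OF W(2) p0F] by blast
    ultimately show ?thesis using W(1) by (intro exI[of _ ?D]) blast
  qed
  have q: "2 * (d + \<gamma>) = 2 * d + 2 * \<gamma> / \<beta> * \<beta>" using pos by simp
  have "\<exists>\<eta>. (\<forall>x\<in>F. \<eta> x \<in> borel_measurable \<Omega> \<and> (AE \<omega> in \<Omega>. \<eta> x \<omega> = \<xi> x \<omega>)) \<and>
             (AE \<omega> in \<Omega>. \<forall>g. 0 < g \<and> g < 2 * \<gamma> / \<beta> \<longrightarrow>
                (\<exists>c. \<forall>x\<in>F. \<forall>y\<in>F. dist (\<eta> x \<omega>) (\<eta> y \<omega>) \<le> c * \<rho> x y powr g))"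
  proof (rule kolmogorov_continuity_entropy[OF metric diam nets])
    show "\<xi> x \<in> borel_measurable \<Omega>" if "x \<in> F" for x using meas that by (simp add: is_process_def)
    show "(\<integral>\<^sup>+\<omega>. ennreal (dist (\<xi> x \<omega>) (\<xi> y \<omega>) powr \<beta>) \<partial>\<Omega>)
        \<le> ennreal (C * \<kappa> powr (d + \<gamma>) * \<rho> x y powr (2 * d + 2 * \<gamma> / \<beta> * \<beta>))" if "x \<in> F" "y \<in> F" for x y
      using moment[OF that] R_powr[OF that, of "d + \<gamma>"] unfolding q by (simp add: mult.assoc)
  qed (use d pos in auto)
  then obtain \<eta> where \<eta>: "\<And>x. x \<in> F \<Longrightarrow> \<eta> x \<in> borel_measurable \<Omega>"
      "\<And>x. x \<in> F \<Longrightarrow> AE \<omega> in \<Omega>. \<eta> x \<omega> = \<xi> x \<omega>"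
      "AE \<omega> in \<Omega>. \<forall>g. 0 < g \<and> g < 2 * \<gamma> / \<beta> \<longrightarrow>
                (\<exists>c. \<forall>x\<in>F. \<forall>y\<in>F. dist (\<eta> x \<omega>) (\<eta> y \<omega>) \<le> c * \<rho> x y powr g)"
    by blast
  have "is_version \<Omega> F \<xi> \<eta>" unfolding is_version_def is_process_def using \<eta>(1,2) by blast
  moreover have "AE \<omega> in \<Omega>. essentially_hoelder F R dist (\<gamma> / \<beta>) (\<lambda>x. \<eta> x \<omega>)"
    using \<eta>(3)
  proof eventually_elim
    case (elim \<omega>)
    have hoelder: "\<exists>c. \<forall>x\<in>F. \<forall>y\<in>F. dist (\<eta> x \<omega>) (\<eta> y \<omega>) \<le> c * R x y powr g"
      if g: "0 < g" "g < \<gamma> / \<beta>" for g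
    proof -
      have "0 < 2 * g \<and> 2 * g < 2 * \<gamma> / \<beta>" using g by simp
      then obtain c where c: "\<And>x y. x \<in> F \<Longrightarrow> y \<in> F \<Longrightarrow> dist (\<eta> x \<omega>) (\<eta> y \<omega>) \<le> c * \<rho> x y powr (2 * g)"
        using elim by blast
      have "dist (\<eta> x \<omega>) (\<eta> y \<omega>) \<le> (c / \<kappa> powr g) * R x y powr g" if "x \<in> F" "y \<in> F" for x y
        using c[OF that] R_powr[OF that, of g] \<kappa>_pos by simp
      then show ?thesis by blast
    qed
    have "\<exists>e'>0. \<forall>y\<in>F. R x y < e' \<longrightarrow> dist (\<eta> x \<omega>) (\<eta> y \<omega>) < e" if x: "x \<in> F" and e: "0 < e" for x e
    proof -
      define g where "g = \<gamma> / \<beta> / 2"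
      have g: "0 < g" "g < \<gamma> / \<beta>" using pos by (auto simp: g_def field_simps)
      obtain c where c: "\<And>x y. x \<in> F \<Longrightarrow> y \<in> F \<Longrightarrow> dist (\<eta> x \<omega>) (\<eta> y \<omega>) \<le> c * R x y powr g"
        using hoelder[OF g] by blast
      define c' where "c' = \<bar>c\<bar> + 1"
      have c': "0 < c'" "c \<le> c'" by (auto simp: c'_def)
      have "dist (\<eta> x \<omega>) (\<eta> y \<omega>) < e" if y: "y \<in> F" "R x y < (e / c') powr (1 / g)" for y
      proof -
        have "R x y powr g < ((e / c') powr (1 / g)) powr g"
          using y R_nonneg[OF x y(1)] g by (intro powr_less_mono2) auto
        then have "R x y powr g < e / c'" using g e c' by (simp add: powr_powr)
        then have "c' * R x y powr g < e" using c' by (simp add: field_simps)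
        moreover have "c * R x y powr g \<le> c' * R x y powr g" using c' by (intro mult_right_mono) auto
        ultimately show ?thesis using c[OF x y(1)] by linarith
      qed
      moreover have "0 < (e / c') powr (1 / g)" using e c' by simp
      ultimately show ?thesis by blast
    qed
    then show ?case unfolding essentially_hoelder_def using hoelder by blast
  qed
  ultimately show ?thesis by blast
qed

end

theorem theorem3p14:
  fixes M :: nat
    and F :: "'a::metric_space set"
    and \<psi> :: "nat \<Rightarrow> 'a \<Rightarrow> 'a"
    and A :: "'a \<Rightarrow> 'a \<Rightarrow> real"
    and r :: "nat \<Rightarrow> real"
    and d\<^sub>H :: real
    and \<Omega> :: "'w measure"
    and \<xi> :: "'a \<Rightarrow> 'w \<Rightarrow> 'e::polish_space"
    and C \<beta> \<gamma> :: real
  assumes "connected_pcf_set M F \<psi>"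
    and "regular_harmonic_structure M F \<psi> A r"
    and "d\<^sub>H > 0" and "(\<Sum>i\<in>{1..M}. r i powr d\<^sub>H) = 1"
    and "prob_space \<Omega>"
    and "is_process \<Omega> F \<xi>"
    and "C > 0" and "\<beta> > 0" and "\<gamma> > 0"
    and "\<And>x y. x \<in> F \<Longrightarrow> y \<in> F \<Longrightarrow>
           (\<integral>\<^sup>+\<omega>. ennreal (dist (\<xi> x \<omega>) (\<xi> y \<omega>) powr \<beta>) \<partial>\<Omega>)
             \<le> ennreal (C * resistance M F \<psi> A r x y powr (d\<^sub>H + \<gamma>))"
  shows "\<exists>\<eta>. is_version \<Omega> F \<xi> \<eta> \<and>
           (AE \<omega> in \<Omega>. essentially_hoelder F (resistance M F \<psi> A r) dist (\<gamma> / \<beta>) (\<lambda>x. \<eta> x \<omega>))"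
proof -
  interpret harmonic_structure M F \<psi> A r
    using assms(1,2) by unfold_locales
  show ?thesis
    using assms(3,4,6-9) assms(10) by (rule kolmogorov_on_resistance_space)
qed

end
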